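(* Let $K$ be a real quadratic field and $R$ its ring of integers. For a unit $\alpha\in R\setminus\{\pm1\}$, let $\Delta=(\Delta_n)_{n\geqslant1}$ be the integer sequence $\Delta_n=N_{K/\mathbb{Q}}(\alpha^n-1)$. Then: (i) there exists a positive integer $C_1$ such that for all units $\alpha\in R\setminus\{\pm1\}$ of norm $1$, $Z(\Delta)\leqslant C_1$; (ii) there exists a positive integer $C_2$ such that for all units $\alpha\in R\setminus\{\pm1\}$ of norm $-1$, $\Delta_n$ has a primitive prime divisor for every $n>C_2$ with $n\not\equiv2\pmod4$.
   Context: For an integer sequence $A=(a_n)_{n\geqslant1}$, a prime $p$ dividing $a_n$ is called a primitive prime divisor of $a_n$ if $p$ does not divide $a_m$ for any $m<n$ with $a_m\neq0$. The Zsigmondy bound of $A$ is $Z(A)=\max\{n: a_n\text{ does not have a primitive prime divisor}\}$ if this set is finite, and $Z(A)=\infty$ otherwise; if the set is empty, any inequality $Z(A)\leqslant c$ with $c>0$ is regarded as true. Norm means the field norm $N_{K/\mathbb{Q}}$. *)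

theory Defs
  imports
    "HOL-Computational_Algebra.Polynomial"
    "HOL-Computational_Algebra.Primes"
    "HOL-Combinatorics.Permutations"
    "HOL-Library.Extended_Nat"
begin

section \<open>Real quadratic fields as types\<close>

interpretation rat_vs: vector_space "\<lambda>(q::rat) (x::'k::field_char_0). of_rat q * x"
  by unfold_locales (simp_all add: algebra_simps of_rat_add of_rat_mult)

text \<open>A field homomorphism is automatically injective, hence an embedding.\<close>

definition field_embedding :: "('k::field \<Rightarrow> 'l::field) \<Rightarrow> bool" where
  "field_embedding \<sigma> \<longleftrightarrow>
     \<sigma> 1 = 1 \<and> (\<forall>x y. \<sigma> (x + y) = \<sigma> x + \<sigma> y) \<and> (\<forall>x y. \<sigma> (x * y) = \<sigma> x * \<sigma> y)"

text \<open>The type \<open>'k\<close> itself plays the role of the field \<open>K\<close>. Note that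
  \<open>rat_vs.dim UNIV\<close> is \<open>0\<close> for infinite-dimensional spaces, so dimension \<open>2\<close>
  really means that there is a two-element basis. A quadratic field is real iff it has
  one, equivalently only, real embeddings.\<close>

definition real_quadratic_field :: "'k::field_char_0 itself \<Rightarrow> bool" where
  "real_quadratic_field _ \<longleftrightarrow>
     rat_vs.dim (UNIV :: 'k set) = 2 \<and> (\<exists>\<sigma> :: 'k \<Rightarrow> real. field_embedding \<sigma>)"

definition ring_of_integers :: "'k::field_char_0 set" where
  "ring_of_integers = {x. algebraic_int x}"

definition integer_units :: "'k::field_char_0 set" where
  "integer_units = {x \<in> ring_of_integers. \<exists>y\<in>ring_of_integers. x * y = 1}"


section \<open>The field norm\<close>

text \<open>The norm of \<open>x\<close> is the determinant of the rational-linear map \<open>y \<mapsto> x * y\<close>, written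
  as a Leibniz sum over the permutations of a basis; it does not depend on the
  basis chosen.\<close>

definition field_norm :: "'k::field_char_0 \<Rightarrow> rat" where
  "field_norm x =
     (let B = (SOME B. rat_vs.independent B \<and> rat_vs.span B = UNIV) in
      \<Sum>\<pi> | \<pi> permutes B.
        of_int (sign \<pi>) * (\<Prod>b\<in>B. rat_vs.representation B (x * b) (\<pi> b)))"

text \<open>The norm of an algebraic integer is an integer, so the floor below only changes
  the type; this is lemma \<open>of_int_norm_seq\<close>.\<close>

definition norm_seq :: "'k::field_char_0 \<Rightarrow> nat \<Rightarrow> int" where
  "norm_seq \<alpha> n = \<lfloor>field_norm (\<alpha> ^ n - 1)\<rfloor>"


section \<open>Primitive prime divisors and the Zsigmondy bound\<close>

text \<open>Sequences are indexed from \<open>1\<close>; the value at \<open>0\<close> is never used.\<close>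

definition primitive_prime_divisor :: "(nat \<Rightarrow> int) \<Rightarrow> nat \<Rightarrow> nat \<Rightarrow> bool" where
  "primitive_prime_divisor a n p \<longleftrightarrow>
     prime p \<and> int p dvd a n \<and> (\<forall>m. 1 \<le> m \<and> m < n \<and> a m \<noteq> 0 \<longrightarrow> \<not> int p dvd a m)"

definition has_primitive_prime_divisor :: "(nat \<Rightarrow> int) \<Rightarrow> nat \<Rightarrow> bool" where
  "has_primitive_prime_divisor a n \<longleftrightarrow> (\<exists>p. primitive_prime_divisor a n p)"

text \<open>The value \<open>0\<close> in the empty case makes every bound \<open>zsigmondy_bound a \<le> c\<close> with
  \<open>c > 0\<close> true.\<close>

definition zsigmondy_bound :: "(nat \<Rightarrow> int) \<Rightarrow> enat" where
  "zsigmondy_bound a =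
     (let S = {n. 1 \<le> n \<and> \<not> has_primitive_prime_divisor a n} in
      if S = {} then 0 else if finite S then enat (Max S) else \<infinity>)"


section \<open>Integrality of the norm sequence\<close>

lemma clear_denominators:
  fixes q :: "rat poly"
  shows "\<exists>(c::int) Q. c > 0 \<and> map_poly of_int Q = smult (of_int c) q"
proof (induction q)
  case 0
  show ?case by (intro exI[of _ 1] exI[of _ 0]) auto
next
  case (pCons a q)
  then obtain c Q where cQ: "c > 0" "map_poly of_int Q = smult (of_int c) q" by blast
  obtain x y where xy: "a = of_int x / of_int y" "y > 0"
    by (metis quotient_of_denom_pos quotient_of_div surj_pair)
  have "map_poly of_int (pCons (c * x) (smult y Q)) = smult (of_int (c * y)) (pCons a q)"
    using cQ xy by (simp add: map_poly_pCons map_poly_smult mult.commute)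
  moreover have "c * y > 0" using cQ xy by simp
  ultimately show ?case by blast
qed

lemma monic_rat_factor_int:
  fixes q s :: "rat poly" and P :: "int poly"
  assumes "q * s = map_poly of_int P" "lead_coeff P = 1" "lead_coeff q = 1"
  shows "coeff q i \<in> \<int>"
proof -
  have "lead_coeff (q * s) = 1"
    using assms(1,2) by (simp add: degree_map_poly coeff_map_poly)
  hence s: "lead_coeff s = 1" using assms(3) by (simp add: lead_coeff_mult)
  obtain c Q where Q: "c > 0" "map_poly of_int Q = smult (of_int c) q"
    using clear_denominators by blast
  obtain d S where S: "d > 0" "map_poly of_int S = smult (of_int d) s"
    using clear_denominators by blast
  have coQ: "of_int (coeff Q j) = of_int c * coeff q j" for j
    using arg_cong[OF Q(2), of "\<lambda>p. coeff p j"] by (simp add: coeff_map_poly)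
  have coS: "of_int (coeff S j) = of_int d * coeff s j" for j
    using arg_cong[OF S(2), of "\<lambda>p. coeff p j"] by (simp add: coeff_map_poly)
  have "coeff Q (degree q) = c"
    using coQ[of "degree q"] assms(3) by simp
  hence 1: "content Q dvd c" using content_dvd_coeff by metis
  have "coeff S (degree s) = d"
    using coS[of "degree s"] s by simp
  hence 2: "content S dvd d" using content_dvd_coeff by metis
  have "Q * S = smult (c * d) P"
  proof (rule poly_eqI)
    fix j
    have "(of_int (coeff (Q * S) j) :: rat) =
          (\<Sum>i\<le>j. of_int (coeff Q i) * of_int (coeff S (j - i)))"
      by (simp add: coeff_mult)
    also have "\<dots> = of_int (c * d) * coeff (q * s) j"
      by (simp add: coQ coS coeff_mult sum_distrib_left mult_ac)
    also have "\<dots> = of_int (coeff (smult (c * d) P) j)"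
      by (simp add: assms(1) coeff_map_poly)
    finally show "coeff (Q * S) j = coeff (smult (c * d) P) j"
      by (simp only: of_int_eq_iff)
  qed
  hence "content Q * content S = content (smult (c * d) P)"
    by (metis content_mult)
  also have "content P dvd 1" using content_dvd_coeff[of P "degree P"] assms(2) by simp
  hence "content P = 1" by (metis is_unit_content_iff)
  hence "content (smult (c * d) P) = c * d" using Q(1) S(1) by simp
  finally have 3: "content Q * content S = c * d" .
  have "content T \<ge> 0" for T :: "int poly"
    by (metis abs_ge_zero normalize_content normalize_int_def)
  moreover have "content Q \<noteq> 0" "content S \<noteq> 0" using 1 2 Q(1) S(1) by auto
  ultimately have "content Q > 0" "content S > 0" by (simp_all add: order_less_le)
  moreover have "content Q \<le> c" "content S \<le> d" using 1 2 Q(1) S(1) by (auto intro: zdvd_imp_le)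
  ultimately have "content Q = c"
    using 3 Q(1) S(1) by (smt (verit) mult_left_mono mult_right_mono mult_strict_right_mono)
  hence "c dvd coeff Q i" using content_dvd_coeff by metis
  then obtain k where "coeff Q i = c * k" by blast
  hence "coeff q i = of_int k" using coQ[of i] Q(1) by simp
  thus ?thesis by simp
qed

lemma quadratic_coeffs_int:
  fixes x :: "'k::field_char_0" and t N :: rat
  assumes "algebraic_int x" "x \<notin> \<rat>" "x\<^sup>2 - of_rat t * x + of_rat N = 0"
  shows "t \<in> \<int>" "N \<in> \<int>"
proof -
  define q where "q = [:N, -t, 1:]"
  define ev where "ev p = poly (map_poly of_rat p) x" for p
  have ev_0: "ev 0 = 0" and ev_pCons: "ev (pCons a p) = of_rat a + x * ev p" for a p
    by (simp_all add: ev_def map_poly_pCons)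
  have ev_add: "ev (p + r) = ev p + ev r" for p r
    by (induction p r rule: poly_induct2) (simp_all add: ev_0 ev_pCons of_rat_add algebra_simps)
  have ev_smult: "ev (smult a p) = of_rat a * ev p" for a p
    by (induction p) (simp_all add: ev_0 ev_pCons of_rat_mult algebra_simps)
  have ev_mult: "ev (p * r) = ev p * ev r" for p r
    by (induction p) (simp_all add: ev_0 ev_pCons ev_add ev_smult algebra_simps)
  obtain P where P: "poly (map_poly of_int P) x = 0" "lead_coeff P = 1"
    using assms(1) unfolding algebraic_int_altdef_ipoly by blast
  define P' :: "rat poly" where "P' = map_poly of_int P"
  have evP: "ev P' = 0"
    using P(1) by (simp add: ev_def P'_def map_poly_map_poly o_def)
  have evq: "ev q = 0"
    using assms(3) by (simp add: q_def ev_pCons ev_0 of_rat_minus algebra_simps power2_eq_square)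
  have q0: "q \<noteq> 0" "degree q = 2" by (simp_all add: q_def)
  define r where "r = P' mod q"
  have "ev r = 0"
    using evP evq ev_add[of "q * (P' div q)" r] ev_mult[of q "P' div q"] by (simp add: r_def)
  have "degree r < 2" using degree_mod_less[OF q0(1), of P'] q0(2) by (auto simp: r_def)
  obtain a b where r: "r = [:a, b:]"
  proof
    show "r = [:coeff r 0, coeff r 1:]"
      using \<open>degree r < 2\<close>
      by (auto simp: poly_eq_iff coeff_pCons coeff_eq_0 split: nat.splits)
  qed
  hence ab: "of_rat a + of_rat b * x = 0"
    using \<open>ev r = 0\<close> by (simp add: ev_pCons ev_0 mult.commute)
  have "b = 0"
  proof (rule ccontr)
    assume "b \<noteq> 0"
    hence "x = of_rat (- a / b)"
      using ab by (simp add: of_rat_minus of_rat_divide field_simps add_eq_0_iff)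
    thus False using assms(2) by simp
  qed
  hence "r = 0" using ab r by simp
  hence "q * (P' div q) = map_poly of_int P"
    using mult_div_mod_eq[of q P'] by (simp add: r_def P'_def)
  from monic_rat_factor_int[OF this P(2)]
  have *: "coeff q i \<in> \<int>" for i using q0 by (simp add: q_def)
  show "N \<in> \<int>" using *[of 0] by (simp add: q_def)
  show "t \<in> \<int>" using *[of 1] by (simp add: q_def)
qed

lemma quadratic_basis:
  fixes B :: "'k::field_char_0 set"
  assumes "rat_vs.dim (UNIV :: 'k set) = 2"
  defines "B \<equiv> (SOME B. rat_vs.independent B \<and> rat_vs.span B = UNIV)"
  shows "\<exists>b1 b2. b1 \<noteq> b2 \<and> B = {b1, b2} \<and> rat_vs.independent B \<and> rat_vs.span B = UNIV"
proof -
  have ex: "\<exists>B :: 'k set. rat_vs.independent B \<and> rat_vs.span B = UNIV"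
    by (metis rat_vs.independent_empty rat_vs.independent_extend_basis rat_vs.span_extend_basis)
  have B: "rat_vs.independent B" "rat_vs.span B = UNIV"
    using someI_ex[OF ex] unfolding B_def by blast+
  hence "card B = 2"
    using rat_vs.dim_eq_card[of B UNIV] assms(1) by simp
  thus ?thesis using B by (auto simp: card_2_iff)
qed

lemma field_norm_quadratic:
  fixes x :: "'k::field_char_0"
  assumes "rat_vs.dim (UNIV :: 'k set) = 2"
  obtains a b c d where
    "\<And>u v. field_norm (of_rat u + of_rat v * x) = (u + v * a) * (u + v * d) - (v * b) * (v * c)"
    "x\<^sup>2 - of_rat (a + d) * x + of_rat (a * d - b * c) = 0"
proof -
  define B where "B = (SOME B :: 'k set. rat_vs.independent B \<and> rat_vs.span B = UNIV)"
  obtain b1 b2 where B: "b1 \<noteq> b2" "B = {b1, b2}" "rat_vs.independent B" "rat_vs.span B = UNIV"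
    using quadratic_basis[OF assms] unfolding B_def by blast
  let ?R = "rat_vs.representation B"
  have expand: "y = of_rat (?R y b1) * b1 + of_rat (?R y b2) * b2" for y
    using rat_vs.sum_representation_eq[OF B(3), of y B] B by simp
  define a b c d where "a = ?R (x * b1) b1" and "b = ?R (x * b1) b2"
    and "c = ?R (x * b2) b1" and "d = ?R (x * b2) b2"
  have 1: "x * b1 = of_rat a * b1 + of_rat b * b2"
    using expand[of "x * b1"] by (simp add: a_def b_def)
  have 2: "x * b2 = of_rat c * b1 + of_rat d * b2"
    using expand[of "x * b2"] by (simp add: c_def d_def)
  have b1: "b1 \<noteq> 0" using B(2,3) rat_vs.dependent_zero by blast
  show ?thesis
  proof
    fix u v
    have R: "?R ((of_rat u + of_rat v * x) * z) w = u * ?R z w + v * ?R (x * z) w" for z w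
    proof -
      have "(of_rat u + of_rat v * x) * z = of_rat u * z + of_rat v * (x * z)"
        by (simp add: algebra_simps)
      thus ?thesis
        using B(3,4) by (simp add: rat_vs.representation_add rat_vs.representation_scale)
    qed
    have Rb: "?R b1 b1 = 1" "?R b1 b2 = 0" "?R b2 b1 = 0" "?R b2 b2 = 1"
      using B by (simp_all add: rat_vs.representation_basis)
    have perms: "{\<pi>. \<pi> permutes B} = {id, Transposition.transpose b1 b2}"
      by (auto simp: B(2) permutes_doubleton_iff)
    have "Transposition.transpose b1 b2 \<noteq> id"
      using B(1) by (metis id_apply transpose_apply_first)
    moreover have "(\<Prod>z\<in>B. f z) = f b1 * f b2" for f :: "'k \<Rightarrow> rat"
      using B(1) by (simp add: B(2))
    ultimately show "field_norm (of_rat u + of_rat v * x) =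
        (u + v * a) * (u + v * d) - (v * b) * (v * c)"
      unfolding field_norm_def B_def[symmetric] Let_def perms
      using B(1) by (simp add: R Rb sign_swap_id a_def b_def c_def d_def)
  next
    have "(x - of_rat d) * (of_rat b * b2) = of_rat b * (of_rat c * b1)"
    proof -
      have "(x - of_rat d) * (of_rat b * b2) = of_rat b * (x * b2 - of_rat d * b2)"
        by (simp add: algebra_simps)
      thus ?thesis unfolding 2 by simp
    qed
    moreover have "of_rat b * b2 = (x - of_rat a) * b1"
      using 1 by (simp add: algebra_simps)
    ultimately have "(x - of_rat d) * ((x - of_rat a) * b1) = of_rat b * (of_rat c * b1)"
      by simp
    hence "((x - of_rat d) * (x - of_rat a) - of_rat (b * c)) * b1 = 0"
      by (simp add: algebra_simps of_rat_mult)
    hence "(x - of_rat d) * (x - of_rat a) - of_rat (b * c) = 0"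
      using b1 by simp
    thus "x\<^sup>2 - of_rat (a + d) * x + of_rat (a * d - b * c) = 0"
      by (simp add: algebra_simps of_rat_mult of_rat_add of_rat_diff power2_eq_square)
  qed
qed

lemma of_int_norm_seq:
  fixes \<alpha> :: "'k::field_char_0"
  assumes "real_quadratic_field TYPE('k)" "\<alpha> \<in> ring_of_integers"
  shows "of_int (norm_seq \<alpha> n) = field_norm (\<alpha> ^ n - 1)"
proof -
  have dim: "rat_vs.dim (UNIV :: 'k set) = 2" and alg: "algebraic_int \<alpha>"
    using assms by (auto simp: real_quadratic_field_def ring_of_integers_def)
  obtain a b c d where
    N: "\<And>u v. field_norm (of_rat u + of_rat v * \<alpha>) = (u + v * a) * (u + v * d) - (v * b) * (v * c)"
    and eq: "\<alpha>\<^sup>2 - of_rat (a + d) * \<alpha> + of_rat (a * d - b * c) = 0"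
    by (rule field_norm_quadratic[OF dim, of \<alpha>]) (rule that)
  have "field_norm (\<alpha> ^ n - 1) \<in> \<int>"
  proof (cases "\<alpha> \<in> \<rat>")
    case True
    then obtain m where "\<alpha> = of_int m"
      using rational_algebraic_int_is_int[OF alg] by (auto elim: Ints_cases)
    hence "\<alpha> ^ n - 1 = of_rat (of_int (m ^ n - 1)) + of_rat 0 * \<alpha>"
      by (simp only: of_rat_of_int_eq) simp
    thus ?thesis by (simp only: N) simp
  next
    case False
    from quadratic_coeffs_int[OF alg False eq]
    obtain t D where t: "a + d = of_int t" and D: "a * d - b * c = of_int D"
      by (auto elim!: Ints_cases)
    have sq: "\<alpha> * \<alpha> = of_int t * \<alpha> - of_int D"
      using eq by (simp add: t D power2_eq_square algebra_simps add_eq_0_iff)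
    have "\<exists>u v. \<alpha> ^ n = of_int u + of_int v * \<alpha>"
    proof (induction n)
      case 0
      show ?case by (intro exI[of _ 1] exI[of _ 0]) simp
    next
      case (Suc n)
      then obtain u v where "\<alpha> ^ n = of_int u + of_int v * \<alpha>" by blast
      hence "\<alpha> ^ Suc n = of_int u * \<alpha> + of_int v * (\<alpha> * \<alpha>)"
        by (simp add: algebra_simps)
      also have "\<dots> = of_int (- v * D) + of_int (u + v * t) * \<alpha>"
        unfolding sq by (simp add: algebra_simps)
      finally show ?case by blast
    qed
    then obtain u v where "\<alpha> ^ n = of_int u + of_int v * \<alpha>" by blast
    hence "\<alpha> ^ n - 1 = of_rat (of_int (u - 1)) + of_rat (of_int v) * \<alpha>"
      by (simp only: of_rat_of_int_eq) simp
    hence "field_norm (\<alpha> ^ n - 1) =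
        (of_int (u - 1) + of_int v * a) * (of_int (u - 1) + of_int v * d)
        - (of_int v * b) * (of_int v * c)"
      by (simp only: N)
    also have "\<dots> = of_int (u - 1) ^ 2 + of_int (u - 1) * of_int v * (a + d)
        + of_int v ^ 2 * (a * d - b * c)"
      by (simp add: algebra_simps power2_eq_square)
    also have "\<dots> = of_int ((u - 1)\<^sup>2 + (u - 1) * v * t + v ^ 2 * D)"
      unfolding t D by simp
    finally show ?thesis by simp
  qed
  thus ?thesis by (auto simp: norm_seq_def elim: Ints_cases)
qed

end

(*
  For a unit of norm 1 with conjugates A, B = 1/A the sequence is -D_n with D_n = A^n + B^n - 2, and
  the primes p dividing D_n are controlled by a rank of apparition m: p | D_n forces m | n.  Let
  F_n be the product of the D_d^mu(n/d) over d | n, the cyclotomic part of D_n.  Lifting the exponent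
  shows that p divides F_n only if n = m p^j, and then p^3 does not divide F_n once j >= 1 and n > 36.
  So if n has no primitive divisor, |F_n| <= n^2, whereas ln |F_n| >= phi(n) ln 2 - 2^omega(n) ln 4.
  Since 2^omega(n) = O(sqrt(phi(n))), this bounds n independently of the unit.  A unit of norm -1 is
  reduced to its square: Delta_2k is minus the k-th term for A^2, B^2, and Delta_n^2 is the n-th one
  when n is odd.
*)

theory Submission
  imports Defs "HOL-Real_Asymp.Real_Asymp"
begin

section \<open>Iterated multiplicative differences\<close>

text \<open>For distinct primes \<open>ps\<close> and \<open>n = r * prod_list ps\<close> with the same prime divisors, \<open>mdiff ps f r\<close>
  is the Moebius sum of \<open>\<mu>(n / d) f(d)\<close> over the divisors \<open>d\<close> of \<open>n\<close>.\<close>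

primrec mdiff :: "nat list \<Rightarrow> (nat \<Rightarrow> real) \<Rightarrow> nat \<Rightarrow> real" where
  "mdiff [] f = f"
| "mdiff (q # qs) f = mdiff qs (\<lambda>k. f (q * k) - f k)"

lemma mdiff_cong:
  assumes "\<And>s. s dvd prod_list ps \<Longrightarrow> f (r * s) = g (r * s)"
  shows "mdiff ps f r = mdiff ps g r"
  using assms
proof (induction ps arbitrary: f g)
  case Nil
  then show ?case by (metis mdiff.simps(1) mult.right_neutral one_dvd)
next
  case (Cons q qs)
  have "f (q * (r * s)) - f (r * s) = g (q * (r * s)) - g (r * s)" if "s dvd prod_list qs" for s
    using Cons.prems[of "q * s"] Cons.prems[of s] that
    by (simp add: mult.left_commute dvd_mult mult_dvd_mono)
  from Cons.IH[of "\<lambda>k. f (q * k) - f k" "\<lambda>k. g (q * k) - g k", OF this]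
  show ?case by simp
qed

text \<open>The difference operators commute, so the prime that decides the behaviour of
  \<open>f\<close> can be applied first.\<close>

lemma mdiff_move_front: "mdiff (ps @ q # qs) f = mdiff (q # ps @ qs) f"
proof (induction ps arbitrary: f)
  case (Cons a ps)
  have "mdiff ((a # ps) @ q # qs) f
      = mdiff (ps @ qs) (\<lambda>k. (f (a * (q * k)) - f (q * k)) - (f (a * k) - f k))"
    by (simp add: Cons.IH)
  also have "(\<lambda>k. (f (a * (q * k)) - f (q * k)) - (f (a * k) - f k))
      = (\<lambda>k. (f (q * (a * k)) - f (a * k)) - (f (q * k) - f k))"
    by (simp add: mult.left_commute algebra_simps)
  finally show ?case by simp
qed simp

lemma mdiff_add: "mdiff ps (\<lambda>k. f k + g k) r = mdiff ps f r + mdiff ps g r"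
proof (induction ps arbitrary: f g)
  case (Cons q qs)
  have "mdiff (q # qs) (\<lambda>k. f k + g k)
      = mdiff qs (\<lambda>k. (f (q * k) - f k) + (g (q * k) - g k))"
    by (simp add: algebra_simps)
  then show ?case by (simp only: Cons.IH mdiff.simps)
qed simp

lemma mdiff_sum:
  "mdiff ps (\<lambda>k. \<Sum>i\<in>I. c i * f i k) r = (\<Sum>i\<in>I. c i * mdiff ps (f i) r)"
proof (induction ps arbitrary: f)
  case (Cons q qs)
  have "mdiff (q # qs) (\<lambda>k. \<Sum>i\<in>I. c i * f i k)
      = mdiff qs (\<lambda>k. \<Sum>i\<in>I. c i * (f i (q * k) - f i k))"
    by (simp add: sum_subtractf[symmetric] right_diff_distrib)
  then show ?case by (simp only: Cons.IH mdiff.simps)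
qed simp

lemma mdiff_zero: "mdiff ps (\<lambda>k. 0) r = 0"
  by (induction ps) simp_all

text \<open>When \<open>ps\<close> lists the distinct prime divisors of n = r * prod_list ps, the
  value is c times Euler's phi(n). This is the main term of the logarithmic estimate.\<close>

lemma mdiff_linear:
  "mdiff ps (\<lambda>k. c * real k) r = c * real r * (\<Prod>p\<leftarrow>ps. real p - 1)"
proof (induction ps arbitrary: c)
  case (Cons q qs)
  have "mdiff (q # qs) (\<lambda>k. c * real k) = mdiff qs (\<lambda>k. (c * (real q - 1)) * real k)"
    by (simp add: algebra_simps)
  then show ?case by (simp only: Cons.IH) simp
qed simp

text \<open>Each difference at most doubles a sup bound; asking for it only at k >= 1 leaves out
  index 0, where \<open>D\<close> vanishes.\<close>

lemma abs_mdiff_le: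
  assumes "\<And>k. k \<ge> 1 \<Longrightarrow> \<bar>f k\<bar> \<le> C" "r \<ge> 1" "\<And>q. q \<in> set ps \<Longrightarrow> q \<ge> 1"
  shows "\<bar>mdiff ps f r\<bar> \<le> 2 ^ length ps * C"
  using assms
proof (induction ps arbitrary: f C)
  case (Cons q qs)
  have "\<bar>f (q * k) - f k\<bar> \<le> 2 * C" if "k \<ge> 1" for k
  proof -
    have "1 \<le> q * k" using Cons.prems(3)[of q] that by simp
    from Cons.prems(1)[OF this] Cons.prems(1)[OF that] show ?thesis by linarith
  qed
  from Cons.IH[of "\<lambda>k. f (q * k) - f k" "2 * C", OF this Cons.prems(2)] Cons.prems(3) show ?case by simp
qed simp

text \<open>On expanding, the top argument has coefficient 1, and every other argument is
  \<open>r * s\<close> with \<open>s\<close> a proper divisor of the full product, since all factors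
  exceed 1.\<close>

lemma mdiff_top:
  assumes "\<And>s. s dvd prod_list ps \<Longrightarrow> s \<noteq> prod_list ps \<Longrightarrow> f (r * s) = 0"
    and "\<And>q. q \<in> set ps \<Longrightarrow> q \<ge> 2"
  shows "mdiff ps f r = f (r * prod_list ps)"
  using assms
proof (induction ps arbitrary: f)
  case (Cons q qs)
  have q: "q \<ge> 2" using Cons.prems(2) by simp
  have "prod_list qs > 0"
    using Cons.prems(2) by (fastforce simp: prod_list_zero_iff intro!: Nat.gr0I)
  hence less: "prod_list qs < q * prod_list qs" using q by simp
  have f0: "f (r * s) = 0" if "s dvd prod_list qs" for s
    using Cons.prems(1)[of s] that less dvd_imp_le[OF that \<open>prod_list qs > 0\<close>] by auto
  have "f (q * (r * s)) - f (r * s) = 0" if "s dvd prod_list qs" "s \<noteq> prod_list qs" for s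
    using Cons.prems(1)[of "q * s"] f0[OF that(1)] that q
    by (simp add: mult.left_commute mult_dvd_mono)
  from Cons.IH[of "\<lambda>k. f (q * k) - f k", OF this] Cons.prems(2) f0[of "prod_list qs"] show ?case
    by (simp add: mult.left_commute)
qed simp

section \<open>Norms of powers minus one\<close>

text \<open>Summing over the primes of a common multiple \<open>y\<close> gives one index set for
  all its divisors \<open>x\<close>, so that \<open>mdiff_sum\<close> can interchange
  \<open>mdiff\<close> with the sum.\<close>

lemma ln_abs_eq_sum_prime_factors:
  fixes x y :: int
  assumes "x dvd y" "y \<noteq> 0"
  shows "ln \<bar>of_int x :: real\<bar> = (\<Sum>p\<in>prime_factors y. ln (of_int p) * real (multiplicity p x))"
proof -
  have x: "x \<noteq> 0" using assms by auto
  have "\<bar>x\<bar> = (\<Prod>p\<in>prime_factors x. p ^ multiplicity p x)"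
    using prod_prime_factors[OF x] by simp
  also have "\<dots> = (\<Prod>p\<in>prime_factors y. p ^ multiplicity p x)"
  proof (rule prod.mono_neutral_left)
    show "prime_factors x \<subseteq> prime_factors y" by (rule dvd_prime_factors[OF assms(2,1)])
    show "\<forall>p\<in>prime_factors y - prime_factors x. p ^ multiplicity p x = 1"
    proof
      fix p assume "p \<in> prime_factors y - prime_factors x"
      hence "\<not> p dvd x" using x by (auto simp: prime_factors_dvd)
      then show "p ^ multiplicity p x = 1" by (simp add: not_dvd_imp_multiplicity_0)
    qed
  qed simp
  finally have "real_of_int \<bar>x\<bar> = of_int (\<Prod>p\<in>prime_factors y. p ^ multiplicity p x)"
    by (rule arg_cong)
  hence "\<bar>of_int x :: real\<bar> = (\<Prod>p\<in>prime_factors y. of_int p ^ multiplicity p x)"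
    by (simp only: of_int_abs of_int_power of_int_prod)
  hence "ln \<bar>of_int x :: real\<bar> = (\<Sum>p\<in>prime_factors y. ln (of_int p ^ multiplicity p x))"
    by (simp only:) (rule ln_prod, auto)
  also have "\<dots> = (\<Sum>p\<in>prime_factors y. ln (of_int p) * real (multiplicity p x))"
    by (intro sum.cong) (auto simp: ln_realpow in_prime_factors_imp_prime prime_gt_0_int)
  finally show ?thesis .
qed

text \<open>Models the two real conjugates of a unit of norm 1, with \<open>A\<close> the larger in
  absolute value. The bound 2 makes the estimates uniform in the unit;
  \<open>reciprocal_pairI\<close> supplies it.\<close>

locale reciprocal_pair =
  fixes A B :: real
  assumes AB: "A * B = 1" and sum_Ints: "A + B \<in> \<int>" and A_ge: "\<bar>A\<bar> \<ge> 2"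
begin

definition D :: "nat \<Rightarrow> int" where "D n = \<lfloor>A ^ n + B ^ n - 2\<rfloor>"

lemma pow_AB [simp]: "A ^ n * B ^ n = 1" "B ^ n * A ^ n = 1"
  using AB by (simp_all flip: power_mult_distrib add: mult.commute)

lemma of_int_D: "of_int (D n) = A ^ n + B ^ n - 2"
proof -
  have "A ^ n + B ^ n \<in> \<int>"
  proof (induction n rule: less_induct)
    case (less n)
    consider "n = 0" | "n = 1" | k where "n = Suc (Suc k)"
      by (metis One_nat_def not0_implies_Suc)
    then show ?case
    proof cases
      case 3
      have "A ^ n + B ^ n = (A + B) * (A ^ Suc k + B ^ Suc k) - (A * B) * (A ^ k + B ^ k)"
        by (simp add: 3 algebra_simps)
      then show ?thesis using less[of "Suc k"] less[of k] sum_Ints AB 3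
        by simp
    qed (use sum_Ints in auto)
  qed
  then show ?thesis by (auto simp: D_def elim!: Ints_cases)
qed

section \<open>Identities for \<open>D\<close> and the rank of apparition of a prime\<close>

lemma D_eqI: "of_int (D n) = (of_int x :: real) \<Longrightarrow> D n = x"
  by simp

lemma D_0 [simp]: "D 0 = 0"
  by (rule D_eqI) (simp add: of_int_D)

text \<open>In terms of T n = A^n + B^n this is T (c + 2b) + T c = T (c + b) T b, rewritten with T =
  D + 2.\<close>

lemma D_add: "D (c + 2 * b) + D c = D (c + b) * D b + 2 * D (c + b) + 2 * D b"
proof -
  define x y u v where "x = A ^ c" and "y = B ^ c" and "u = A ^ b" and "v = B ^ b"
  have uv: "u * v = 1" by (simp add: u_def v_def)
  have "x * u\<^sup>2 + y * v\<^sup>2 - 2 + (x + y - 2) =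
     (x * u + y * v - 2) * (u + v - 2) + 2 * (x * u + y * v - 2) + 2 * (u + v - 2)"
    using uv by algebra
  hence "real_of_int (D (c + 2 * b) + D c) = of_int (D (c + b) * D b + 2 * D (c + b) + 2 * D b)"
    by (simp add: of_int_D power_add power_even_eq x_def y_def u_def v_def)
  then show ?thesis by (simp only: of_int_eq_iff)
qed

text \<open>Writing A = s^2 gives D n = (s^n - s^(-n))^2. With a = c + b the identity is the square
  of (s^(a+b) - s^(-a-b)) (s^(a-b) - s^(b-a)) = D a - D b.\<close>

lemma D_mult: "D (c + 2 * b) * D c = (D (c + b) - D b)\<^sup>2"
proof -
  define x y u v where "x = A ^ c" and "y = B ^ c" and "u = A ^ b" and "v = B ^ b"
  have uv: "u * v = 1" "x * y = 1" by (simp_all add: u_def v_def x_def y_def)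
  have "(x * u\<^sup>2 + y * v\<^sup>2 - 2) * (x + y - 2) = ((x * u + y * v - 2) - (u + v - 2))\<^sup>2"
    using uv by algebra
  hence "real_of_int (D (c + 2 * b) * D c) = of_int ((D (c + b) - D b)\<^sup>2)"
    by (simp add: of_int_D power_add power_even_eq x_def y_def u_def v_def)
  then show ?thesis by (simp only: of_int_eq_iff)
qed

lemma D_double: "D (2 * k) = D k * (D k + 4)"
  using D_add[of 0 k] by (simp add: algebra_simps)

text \<open>By the two preceding identities \<open>p\<close> divides both the sum and the product of
  \<open>D (a + b)\<close> and \<open>D (a - b)\<close>, hence each of them.\<close>

lemma dvd_D_diff:
  assumes "prime p" "p dvd D a" "p dvd D b" "b \<le> a"
  shows "p dvd D (a - b)"
proof -
  have a: "(a - b) + b = a" using assms by simp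
  have s: "p dvd D (a - b + 2 * b) + D (a - b)"
    unfolding D_add a using assms by simp
  have "p dvd D (a - b + 2 * b) * D (a - b)"
    unfolding D_mult a using assms by (simp add: power2_eq_square)
  then show ?thesis using s assms(1) by (meson dvd_add_right_iff prime_dvd_mult_iff)
qed

text \<open>Repeatedly subtracting \<open>m\<close> keeps \<open>p\<close> a divisor and ends at an
  index below \<open>m\<close>; minimality of \<open>m\<close> forces this remainder to be
  0.\<close>

lemma rank_dvd:
  assumes "prime p" "p dvd D m" "m \<ge> 1" "\<And>k. 1 \<le> k \<Longrightarrow> k < m \<Longrightarrow> \<not> p dvd D k" "p dvd D n"
  shows "m dvd n"
  using assms(5)
proof (induction n rule: less_induct)
  case (less n)
  show ?case
  proof (cases "n < m")
    case True
    then show ?thesis using assms(4)[of n] less.prems by (cases n) auto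
  next
    case False
    hence "p dvd D (n - m)" using dvd_D_diff[OF assms(1) less.prems assms(2)] by simp
    hence "m dvd n - m" using less.IH[of "n - m"] assms(3) False by simp
    then show ?thesis using False by (metis dvd_diffD dvd_refl not_less)
  qed
qed

text \<open>Divide \<open>D_add\<close> with step \<open>k\<close> by \<open>D k\<close>: the
  quotients q i = D (i * k) / D k satisfy q (i+2) = 2 q (i+1) - q i + 2 modulo \<open>D k\<close>,
  and i^2 solves this recurrence with initial values 0 and 1.\<close>

lemma D_expand: "\<exists>z. D (i * k) = D k * (int i ^ 2 + D k * z)"
proof (induction i rule: less_induct)
  case (less i)
  consider "i = 0" | "i = 1" | j where "i = Suc (Suc j)"
    by (metis One_nat_def not0_implies_Suc)
  then show ?case
  proof cases
    case 3
    obtain y z where y: "D (j * k) = D k * (int j ^ 2 + D k * y)"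
      and z: "D (Suc j * k) = D k * (int (Suc j) ^ 2 + D k * z)"
      using less 3 by (metis lessI less_Suc_eq)
    have idx: "j * k + 2 * k = i * k" "j * k + k = Suc j * k" by (simp_all add: 3)
    have "D (i * k) + D (j * k) = D (Suc j * k) * D k + 2 * D (Suc j * k) + 2 * D k"
      using D_add[of "j * k" k] unfolding idx .
    hence "D (i * k) = D (Suc j * k) * D k + 2 * D (Suc j * k) + 2 * D k - D (j * k)" by simp
    also have "\<dots> = D k * (int i ^ 2 + D k * (int (Suc j) ^ 2 + D k * z + 2 * z - y))"
      unfolding y z by (simp add: 3 power2_eq_square algebra_simps)
    finally show ?thesis by blast
  qed (auto intro: exI[of _ 0])
qed

lemma D_dvd: "k dvd n \<Longrightarrow> D k dvd D n"
  by (metis D_expand dvd_def dvd_triv_left mult.commute)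

text \<open>Up to the factor x^(-j), (x^(2j+1) - 1) / (x - 1) is the symmetric sum of the x^i with
  |i| <= j. That sum is invariant under x -> 1/x, so the two conjugate quotients multiply to its
  square; x^i + x^(-i) = D (i * k) + 2 expresses it by integers.\<close>

lemma D_odd_mult:
  "D ((2 * j + 1) * k) = D k * (int (2 * j + 1) + (\<Sum>i=1..j. D (i * k)))\<^sup>2"
proof -
  define x y where "x = A ^ k" and "y = B ^ k"
  have xy: "x * y = 1" "y * x = 1" by (simp_all add: x_def y_def)
  define S where "S j = 1 + (\<Sum>i=1..j. x ^ i + y ^ i)" for j :: nat
  have S: "(x - 1) * S j = x ^ Suc j - y ^ j \<and> (y - 1) * S j = y ^ Suc j - x ^ j" for j
  proof (induction j)
    case 0
    show ?case by (simp add: S_def)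
  next
    case (Suc j)
    have step: "(u - 1) * (s + u * U + v * V) = u * (u * U) - v * V"
      if "(u - 1) * s = u * U - V" "u * v = 1" for s u v U V :: real
      using that by algebra
    have S_Suc: "S (Suc j) = S j + x * x ^ j + y * y ^ j"
      by (simp add: S_def)
    have "(x - 1) * S (Suc j) = x ^ Suc (Suc j) - y ^ Suc j"
      using step[of x "S j" "x ^ j" "y ^ j" y] Suc xy by (simp add: S_Suc)
    moreover have "(y - 1) * S (Suc j) = y ^ Suc (Suc j) - x ^ Suc j"
      using step[of y "S j" "y ^ j" "x ^ j" x] Suc xy by (simp add: S_Suc algebra_simps)
    ultimately show ?case ..
  qed
  have pw: "x ^ j * y ^ j = 1" using xy by (simp flip: power_mult_distrib)
  have "(x - 1) * (y - 1) * (S j)\<^sup>2 = ((x - 1) * S j) * ((y - 1) * S j)"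
    by (simp add: power2_eq_square)
  also have "\<dots> = (x * x ^ j - y ^ j) * (y * y ^ j - x ^ j)" by (simp add: S)
  also have "\<dots> = 2 - x * x ^ j * x ^ j - y * y ^ j * y ^ j"
  proof -
    have "(x * X - Y) * (y * Y - X) = 2 - x * X * X - y * Y * Y" if "X * Y = 1" for X Y
      using that xy(1) by algebra
    from this[OF pw] show ?thesis .
  qed
  also have "\<dots> = 2 - x ^ (2 * j + 1) - y ^ (2 * j + 1)"
    by (simp add: power_add mult_2)
  finally have 1: "(x - 1) * (y - 1) * (S j)\<^sup>2 = 2 - x ^ (2 * j + 1) - y ^ (2 * j + 1)" .
  have "(x - 1) * (y - 1) = 2 - x - y" using xy(1) by algebra
  with 1 have "(2 - x - y) * (S j)\<^sup>2 = 2 - x ^ (2 * j + 1) - y ^ (2 * j + 1)" by metis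
  hence 2: "x ^ (2 * j + 1) + y ^ (2 * j + 1) - 2 = (x + y - 2) * (S j)\<^sup>2"
    unfolding left_diff_distrib distrib_right by linarith
  have Sj: "S j = of_int (int (2 * j + 1) + (\<Sum>i=1..j. D (i * k)))"
    by (simp add: S_def of_int_D sum.distrib sum_subtractf x_def y_def power_mult[symmetric] mult.commute)
  show ?thesis
  proof (rule D_eqI)
    have "real_of_int (D ((2 * j + 1) * k)) = x ^ (2 * j + 1) + y ^ (2 * j + 1) - 2"
      by (simp only: of_int_D x_def y_def power_mult[symmetric] mult.commute[of k])
    also have "\<dots> = of_int (D k) * (of_int (int (2 * j + 1) + (\<Sum>i=1..j. D (i * k))))\<^sup>2"
      using 2 unfolding of_int_D[of k] Sj x_def y_def .
    finally show "real_of_int (D ((2 * j + 1) * k))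
        = of_int (D k * (int (2 * j + 1) + (\<Sum>i=1..j. D (i * k)))\<^sup>2)"
      by (simp only: of_int_mult of_int_power)
  qed
qed

lemma D_triple: "D (3 * k) = D k * (D k + 3)\<^sup>2"
  using D_odd_mult[of 1 k] by (simp add: numeral_3_eq_3 add.commute)

section \<open>Growth of \<open>D\<close>\<close>

lemma abs_B_le: "\<bar>B\<bar> \<le> 1 / 2"
proof -
  have "\<bar>A\<bar> * \<bar>B\<bar> = 1" using AB by (simp flip: abs_mult)
  moreover have "\<bar>A\<bar> * \<bar>B\<bar> \<ge> 2 * \<bar>B\<bar>" using A_ge by (intro mult_right_mono) auto
  ultimately show ?thesis by simp
qed

lemma abs_D: "\<bar>of_int (D k)\<bar> = \<bar>A\<bar> ^ k * (1 - B ^ k)\<^sup>2"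
proof -
  have "a + b - 2 = a * (1 - b)\<^sup>2" if "a * b = 1" for a b :: real
    using that by algebra
  hence "of_int (D k) = A ^ k * (1 - B ^ k)\<^sup>2"
    using pow_AB(1)[of k] by (simp add: of_int_D)
  then show ?thesis by (simp add: abs_mult power_abs)
qed

lemma abs_pow_B_le: "k \<ge> 1 \<Longrightarrow> \<bar>B ^ k\<bar> \<le> 1 / 2"
proof -
  assume "k \<ge> 1"
  have "\<bar>B\<bar> ^ k \<le> \<bar>B\<bar> ^ 1" using \<open>k \<ge> 1\<close> abs_B_le by (intro power_decreasing) auto
  then show ?thesis using abs_B_le by (simp add: power_abs)
qed

lemma D_nonzero: "k \<ge> 1 \<Longrightarrow> D k \<noteq> 0"
  using abs_D[of k] abs_pow_B_le[of k] A_ge by auto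

text \<open>By \<open>abs_D\<close> the deviation is 2 ln (1 - B^k), and 1 - B^k lies between 1/2
  and 2; the bound depends neither on \<open>A\<close> nor on \<open>k\<close>.\<close>

lemma ln_D_approx:
  assumes "k \<ge> 1"
  shows "\<bar>ln (\<bar>of_int (D k)\<bar>) - ln (\<bar>A\<bar>) * real k\<bar> \<le> ln 4"
proof -
  have b: "1 / 2 \<le> 1 - B ^ k" "1 - B ^ k \<le> 2"
    using abs_pow_B_le[OF assms] by (auto simp: abs_le_iff)
  have "ln \<bar>of_int (D k)\<bar> = real k * ln \<bar>A\<bar> + 2 * ln (1 - B ^ k)"
    using A_ge b by (simp add: abs_D ln_mult ln_realpow)
  moreover have "ln (1 - B ^ k) \<le> ln 2" using b by simp
  moreover have "ln (1 / 2) \<le> ln (1 - B ^ k)" using b by (subst ln_le_cancel_iff) auto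
  moreover have "ln (1 / 2 :: real) = - ln 2" by (simp add: ln_div)
  moreover have "ln (4::real) = 2 * ln 2" using ln_realpow[of 2 2] by simp
  ultimately show ?thesis by (simp add: abs_le_iff mult.commute)
qed

section \<open>Multiplicity of a prime in \<open>D\<close> along multiples of its rank\<close>

text \<open>By \<open>D_expand\<close> the cofactor D (q * k) / D k is q^2 modulo
  \<open>D k\<close>, hence not divisible by \<open>p\<close>.\<close>

lemma val_mult_coprime:
  assumes "prime p" "prime q" "p \<noteq> q" "int p dvd D k" "k \<ge> 1"
  shows "multiplicity (int p) (D (q * k)) = multiplicity (int p) (D k)"
proof -
  obtain z where z: "D (q * k) = D k * (int q ^ 2 + D k * z)" using D_expand by blast
  have "\<not> int p dvd int q ^ 2 + D k * z"
  proof
    assume "int p dvd int q ^ 2 + D k * z"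
    hence "int p dvd int q ^ 2" using assms(4) by (meson dvd_add_left_iff dvd_mult2)
    hence "p dvd q" using assms(1) by (metis int_dvd_int_iff prime_dvd_power prime_nat_int_transfer)
    then show False using assms(1-3) primes_dvd_imp_eq by blast
  qed
  moreover from this have "int q ^ 2 + D k * z \<noteq> 0" by auto
  ultimately show ?thesis unfolding z
    using assms(1,5) D_nonzero by (subst prime_elem_multiplicity_mult_distrib)
      (auto simp: not_dvd_imp_multiplicity_0)
qed

lemma val_mult_le_two:
  assumes "prime p" "D n = D k * R" "n \<ge> 1" "\<not> int p ^ 3 dvd R"
  shows "multiplicity (int p) (D n) \<le> multiplicity (int p) (D k) + 2"
proof -
  have nz: "D k \<noteq> 0" "R \<noteq> 0" using D_nonzero[OF assms(3)] assms(2) by auto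
  have "multiplicity (int p) R < 3"
    using assms(1,4) nz(2) by (metis multiplicity_dvd' not_less)
  then show ?thesis unfolding assms(2)
    using assms(1) nz by (subst prime_elem_multiplicity_mult_distrib) auto
qed

text \<open>For p = 2j + 1 the quotient is Q^2, where Q = p + D k (1^2 + ... + j^2) modulo (D k)^2.
  The sum of squares is j (j + 1) p / 6, a multiple of p because p >= 5, so Q is p modulo
  p^2.\<close>

lemma val_prime_mult:
  assumes "prime p" "p \<ge> 5" "int p dvd D k" "k \<ge> 1"
  shows "multiplicity (int p) (D (p * k)) \<le> multiplicity (int p) (D k) + 2"
proof -
  have "odd p" using assms(1,2) prime_odd_nat[of p] by simp
  then obtain j where j: "p = 2 * j + 1" by (elim oddE)
  have "\<forall>i. \<exists>z. D (i * k) = D k * (int i ^ 2 + D k * z)" using D_expand by blast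
  then obtain z where z: "\<And>i. D (i * k) = D k * (int i ^ 2 + D k * z i)" by metis
  define s2 where "s2 = (\<Sum>i=1..j. int i ^ 2)"
  define Q where "Q = int p + (\<Sum>i=1..j. D (i * k))"
  have Q: "Q = int p + D k * s2 + D k * D k * (\<Sum>i=1..j. z i)"
    by (simp add: Q_def z s2_def sum.distrib sum_distrib_left algebra_simps)
  have "6 * s2 = int j * (int j + 1) * int p"
    unfolding s2_def j by (induction j) (simp_all add: power2_eq_square algebra_simps)
  hence "int p dvd 6 * s2" by simp
  moreover have "\<not> int p dvd 6"
  proof
    assume "int p dvd 6"
    hence "p dvd 2 * 3" by presburger
    hence "p dvd 2 \<or> p dvd 3" using assms(1) prime_dvd_mult_iff by blast
    then show False using assms(2) by (auto dest: dvd_imp_le)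
  qed
  ultimately have s2: "int p dvd s2"
    using assms(1) by (meson prime_dvd_mult_iff prime_nat_int_transfer)
  have "\<not> int p ^ 2 dvd Q"
  proof
    assume "int p ^ 2 dvd Q"
    moreover have "int p ^ 2 dvd D k * s2 + D k * D k * (\<Sum>i=1..j. z i)"
      unfolding power2_eq_square using assms(3) s2
      by (intro dvd_add dvd_mult2[of _ "D k * D k"] mult_dvd_mono)
    ultimately have "int p ^ 2 dvd int p"
      using dvd_diff[of "int p ^ 2" Q "D k * s2 + D k * D k * (\<Sum>i=1..j. z i)"]
      by (simp add: Q add.assoc)
    hence "int p * int p \<le> int p"
      using assms(2) zdvd_imp_le[of "int p ^ 2" "int p"] by (simp add: power2_eq_square)
    moreover have "5 * int p \<le> int p * int p" using assms(2) by (intro mult_right_mono) auto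
    ultimately show False using assms(2) by linarith
  qed
  hence "multiplicity (int p) Q < 2" by (metis multiplicity_dvd' not_less)
  moreover have eq: "D (p * k) = D k * Q\<^sup>2"
    using D_odd_mult[of j k] by (simp only: Q_def j)
  moreover have "D (p * k) \<noteq> 0" using D_nonzero[of "p * k"] assms by simp
  ultimately show ?thesis unfolding eq
    using assms(1) by (auto simp: prime_elem_multiplicity_mult_distrib prime_elem_multiplicity_power_distrib)
qed

text \<open>D 3 is D 1 times (D 1 + 3)^2, and D 1 and D 1 + 3 have opposite parity.\<close>

lemma rank_two: "2 dvd D 1 \<or> 2 dvd D 3"
  using D_triple[of 1] by auto

text \<open>Apply D (2k) = D k (D k + 4): if D 1 is 2 modulo 3, then 3 divides D 2; if it is 1, then
  D 2 is 2 and 3 divides D 4.\<close>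

lemma rank_three: "3 dvd D 1 \<or> 3 dvd D 2 \<or> 3 dvd D 4"
proof -
  have "D 1 mod 3 = 0 \<or> D 1 mod 3 = 1 \<or> D 1 mod 3 = 2" by presburger
  then show ?thesis
  proof (elim disjE)
    assume a: "D 1 mod 3 = 1"
    have "(D 1 * (D 1 + 4)) mod 3 = (D 1 mod 3 * ((D 1 mod 3 + 4) mod 3)) mod 3"
      by (simp add: mod_mult_eq mod_add_left_eq)
    hence "D 2 mod 3 = 2" using D_double[of 1] a by simp
    hence "3 dvd D 2 + 4" by presburger
    then show ?thesis using D_double[of 2] by simp
  next
    assume "D 1 mod 3 = 2"
    hence "3 dvd D 1 + 4" by presburger
    then show ?thesis using D_double[of 1] by simp
  qed auto
qed

text \<open>For \<open>p = 2\<close> and \<open>p = 3\<close> the conclusion can fail when \<open>D k\<close> is divisible by a low power of \<open>p\<close>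
  only; \<open>n > 36\<close> excludes this, as the rank is then at most \<open>3\<close> and \<open>4\<close>, respectively.\<close>

lemma val_rank_power:
  assumes p: "prime p" "int p dvd D m" "m \<ge> 1"
    and least: "\<And>k. 1 \<le> k \<Longrightarrow> k < m \<Longrightarrow> \<not> int p dvd D k"
    and n: "n = p * k" "p * k = m * p ^ j" "j \<ge> 1" "n > 36"
  shows "multiplicity (int p) (D n) \<le> multiplicity (int p) (D k) + 2"
proof -
  obtain i where i: "j = Suc i" using n(3) by (cases j) auto
  have k: "k = m * p ^ i" using n(2) p(1) by (simp add: i prime_gt_0_nat mult.left_commute)
  have k1: "k \<ge> 1" using n(1,4) by (cases k) auto
  have pk: "int p dvd D k" using p(2) D_dvd[of m k] k by (meson dvd_trans dvd_triv_left)
  consider "p = 2" | "p = 3" | "p \<ge> 5"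
  proof -
    have "p \<noteq> 4" using p(1) by (auto simp: prime_nat_iff dest: spec[of _ 2])
    then show ?thesis using that prime_ge_2_nat[OF p(1)] by linarith
  qed
  then show ?thesis
  proof cases
    case 1
    have "m \<le> 3"
    proof (rule ccontr)
      assume "\<not> m \<le> 3"
      then show False using least[of 1] least[of 3] rank_two 1 by auto
    qed
    \<comment> \<open>Otherwise n = 2 * m * 2^i <= 24.\<close>
    have "2 ^ i > (4::nat)"
    proof (rule ccontr)
      assume "\<not> 2 ^ i > (4::nat)"
      hence "m * 2 ^ i \<le> 3 * 4" using \<open>m \<le> 3\<close> by (intro mult_mono) auto
      then show False using n k 1 by simp
    qed
    hence "i \<ge> 2" by (cases "i = 0 \<or> i = 1") auto
    hence "2 ^ 2 dvd (2::nat) ^ i" by (rule le_imp_power_dvd)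
    hence "4 * m dvd k" using k 1 by (simp add: mult.commute mult_dvd_mono)
    \<comment> \<open>Two doublings give the factor 8; then D k + 4 is 4 modulo 8, so the quotient D
      n / D k = D k + 4 contains exactly 2^2.\<close>
    moreover have "8 dvd D (4 * m)"
    proof -
      have "2 dvd D m" using p 1 by simp
      hence "2 * 2 dvd D (2 * m)" unfolding D_double by (intro mult_dvd_mono) auto
      hence "4 * 4 dvd D (2 * (2 * m))" unfolding D_double[of "2 * m"] by (intro mult_dvd_mono) auto
      then show ?thesis by (auto intro: dvd_trans[of 8 16])
    qed
    ultimately have "8 dvd D k" using D_dvd dvd_trans by blast
    hence "\<not> int p ^ 3 dvd D k + 4" unfolding 1 by (simp, presburger)
    moreover have "n \<ge> 1" using n(4) by simp
    ultimately show ?thesis using D_double[of k] n(1) p(1) 1 by (intro val_mult_le_two) auto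
  next
    case 2
    have "m \<le> 4"
    proof (rule ccontr)
      assume "\<not> m \<le> 4"
      then show False using least[of 1] least[of 2] least[of 4] rank_three 2 by auto
    qed
    \<comment> \<open>For i = 0 one would have n = 3 * m <= 12.\<close>
    have "i \<noteq> 0" using n k 2 \<open>m \<le> 4\<close> by (cases i) auto
    hence "3 * m dvd k" using k 2 by (cases i) auto
    \<comment> \<open>One tripling gives 9 | D k, so D k + 3 is 3 modulo 9 and its square
      contributes exactly 3^2.\<close>
    moreover have "9 dvd D (3 * m)"
    proof -
      have "3 dvd D m" using p 2 by simp
      hence "3 ^ 2 dvd (D m + 3) ^ 2" by (intro dvd_power_same) auto
      then show ?thesis by (simp add: D_triple)
    qed
    ultimately have "9 dvd D k" using D_dvd dvd_trans by blast
    hence "\<not> 3 ^ 2 dvd D k + 3" by (simp, presburger)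
    hence "multiplicity 3 (D k + 3) < 2" by (metis multiplicity_dvd' not_less)
    moreover have eq: "D n = D k * (D k + 3)\<^sup>2" using D_triple[of k] unfolding n(1) 2 .
    moreover have "D n \<noteq> 0" by (rule D_nonzero) (use n(4) in linarith)
    ultimately show ?thesis using 2
      by (auto simp: prime_elem_multiplicity_mult_distrib prime_elem_multiplicity_power_distrib)
  next
    case 3
    then show ?thesis using val_prime_mult[OF p(1) 3 pk k1] n by simp
  qed
qed

section \<open>The Moebius sum of ln |D| at an index without primitive divisor\<close>

text \<open>Let \<open>m\<close> be the rank of \<open>p\<close>, so that the multiplicity vanishes
  off the multiples of \<open>m\<close>. If a prime q other than \<open>p\<close> divides n / m, the
  q-difference is already zero at all relevant arguments. Otherwise n = m p^j, and only the
  difference between the values at n and n / p survives, which \<open>val_rank_power\<close>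
  bounds.\<close>

lemma mdiff_val_le:
  assumes n: "n = r * prod_list ps" "n > 36"
    and ps: "distinct ps" "set ps = prime_factors n"
    and p: "prime p" "int p dvd D n" "\<exists>m. 1 \<le> m \<and> m < n \<and> int p dvd D m"
  shows "mdiff ps (\<lambda>k. real (multiplicity (int p) (D k))) r \<le> (if p \<in> set ps then 2 else 0)"
proof -
  define f where "f k = real (multiplicity (int p) (D k))" for k
  define m where "m = (LEAST m. 1 \<le> m \<and> int p dvd D m)"
  have m: "1 \<le> m" "int p dvd D m"
    using LeastI_ex[of "\<lambda>m. 1 \<le> m \<and> int p dvd D m"] p(3) unfolding m_def by blast+
  have least: "\<not> int p dvd D k" if "1 \<le> k" "k < m" for k
    using not_less_Least[of k "\<lambda>m. 1 \<le> m \<and> int p dvd D m"] that unfolding m_def by blast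
  have "m < n"
    using p(3) Least_le[of "\<lambda>m. 1 \<le> m \<and> int p dvd D m"] unfolding m_def by fastforce
  have rank: "m dvd k" if "int p dvd D k" for k
    using rank_dvd[OF _ m(2,1) least that] p(1) by simp
  have f0: "f k = 0" if "\<not> m dvd k" for k
    using rank[of k] that unfolding f_def by (metis not_dvd_imp_multiplicity_0 of_nat_0)
  have rank': "int p dvd D k" if "m dvd k" for k
    using m(2) D_dvd[OF that] by (rule dvd_trans)
  have r: "r \<ge> 1" using n by (cases r) auto
  have prime_ps: "prime q" if "q \<in> set ps" for q using ps(2) that by auto
  have coprime_rest: "coprime q (prod_list (as @ bs))" if "ps = as @ q # bs" for q as bs
  proof -
    have "q \<notin> set (as @ bs)" using ps(1) that by auto
    hence "coprime q x" if "x \<in> set (as @ bs)" for x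
      using that \<open>ps = _\<close> prime_ps[of q] prime_ps[of x] by (intro primes_coprime) auto
    then show ?thesis by (intro prod_list_coprime_right) auto
  qed
  have "m dvd n" using rank p(2) by blast
  have "mdiff ps f r \<le> (if p \<in> set ps then 2 else 0)"
  proof (cases "\<exists>q. prime q \<and> q \<noteq> p \<and> m * q dvd n")
    case True
    then obtain q where q: "prime q" "q \<noteq> p" "m * q dvd n" by blast
    hence "q \<in> set ps" using ps(2) n(2) by (auto simp: in_prime_factors_iff dest: dvd_mult_right)
    then obtain as bs where split: "ps = as @ q # bs" by (meson split_list)
    have "f (q * (r * s)) - f (r * s) = 0" if s: "s dvd prod_list (as @ bs)" for s
    proof (cases "m dvd r * s")
      case True
      have "r * s \<ge> 1" using r s n split by (cases s) auto
      then show ?thesis unfolding f_def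
        using val_mult_coprime[OF p(1) q(1) q(2)[symmetric] rank'[OF True]] by simp
    next
      case False
      \<comment> \<open>Otherwise \<open>m\<close> divides q r s and, as m q | n = q r s s', also r
        s s'; since q is coprime to s', it would divide r s.\<close>
      have "\<not> m dvd q * (r * s)"
      proof
        assume 1: "m dvd q * (r * s)"
        obtain s' where s': "prod_list (as @ bs) = s * s'" using s by blast
        have "q * m dvd q * (r * s * s')"
          using q(3) s' by (simp add: n(1) split mult_ac)
        hence "m dvd r * s * s'" using prime_gt_0_nat[OF q(1)] by simp
        hence "m dvd gcd (r * s * q) (r * s * s')" using 1 by (simp add: mult_ac)
        moreover have "coprime q s'"
          using coprime_rest[OF split] unfolding s' by simp
        ultimately have "m dvd r * s"
          by (simp add: gcd_mult_distrib_nat[symmetric] coprime_iff_gcd_eq_1)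
        then show False using False by simp
      qed
      then show ?thesis using False f0 by simp
    qed
    hence "mdiff (as @ bs) (\<lambda>k. f (q * k) - f k) r = mdiff (as @ bs) (\<lambda>k. 0) r"
      by (intro mdiff_cong) auto
    then show ?thesis by (simp add: split mdiff_move_front mdiff_zero del: prod_list.append)
  next
    case False
    obtain c where c: "n = m * c" using \<open>m dvd n\<close> by blast
    \<comment> \<open>\<open>p\<close> already divides a term before index n, so m < n; this makes
      the power of \<open>p\<close> found below nontrivial.\<close>
    have "c > 1" using c \<open>m < n\<close> by (cases c) auto
    obtain j d where d: "c = p ^ j * d" "\<not> p dvd d"
      using multiplicity_decompose'[of c p] \<open>c > 1\<close> p(1) by (metis not_prime_unit gr_implies_not0)
    have "d = 1"
    proof (rule ccontr)
      assume "d \<noteq> 1"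
      then obtain q where q: "prime q" "q dvd d" using prime_factor_nat by blast
      moreover have "q \<noteq> p" using q d by auto
      moreover have "m * q dvd n" using q c d by simp
      ultimately show False using False by blast
    qed
    have "j \<noteq> 0" using d \<open>d = 1\<close> \<open>c > 1\<close> by (cases j) auto
    have "p dvd n" using c d \<open>j \<noteq> 0\<close> by simp
    hence "p \<in> set ps" using ps(2) n(2) p(1) by (auto simp: in_prime_factors_iff)
    then obtain as bs where split: "ps = as @ p # bs" by (meson split_list)
    define P where "P = prod_list (as @ bs)"
    have nP: "n = p * (r * P)" using n(1) by (simp add: split P_def mult_ac)
    \<comment> \<open>A prime q dividing P / s differs from \<open>p\<close>; were p r s a multiple
      of \<open>m\<close>, then m q would divide n, which this case excludes. So only the top term s
      = P remains.\<close>
    have "f (p * (r * s)) - f (r * s) = 0" if s: "s dvd P" "s \<noteq> P" for s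
    proof -
      obtain s' where s': "P = s * s'" using s(1) by blast
      have "s' \<noteq> 1" using s s' by auto
      then obtain q where q: "prime q" "q dvd s'" using prime_factor_nat by blast
      have "q \<noteq> p"
        using q s' coprime_rest[OF split] p(1)
        by (metis P_def coprime_common_divisor dvd_mult dvd_refl not_prime_unit)
      have "\<not> m dvd p * (r * s)"
      proof
        assume "m dvd p * (r * s)"
        hence "m * q dvd p * (r * s) * s'" using q(2) by (rule mult_dvd_mono)
        then show False using False q(1) \<open>q \<noteq> p\<close> by (auto simp: nP s' mult_ac)
      qed
      then show ?thesis using f0 by (metis diff_zero dvd_mult)
    qed
    hence "mdiff (as @ bs) (\<lambda>k. f (p * k) - f k) r = f (p * (r * P)) - f (r * P)"
      unfolding P_def using prime_ps split prime_ge_2_nat by (subst mdiff_top) auto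
    also have "\<dots> \<le> 2"
    proof -
      have "p * (r * P) = m * p ^ j" using nP c d \<open>d = 1\<close> by simp
      hence "multiplicity (int p) (D n) \<le> multiplicity (int p) (D (r * P)) + 2"
        using val_rank_power[OF p(1) m(2,1) least nP _ _ n(2), of j] \<open>j \<noteq> 0\<close> by simp
      then show ?thesis unfolding f_def nP by simp
    qed
    finally show ?thesis using \<open>p \<in> set ps\<close> by (simp add: split mdiff_move_front)
  qed
  then show ?thesis unfolding f_def .
qed

text \<open>Weighting \<open>mdiff_val_le\<close> with ln p over the primes p of D n leaves at most
  twice the sum of ln p over the primes dividing n, that is 2 ln of the radical of n.\<close>

lemma mdiff_ln_le:
  assumes n: "n = r * prod_list ps" "n > 36"
    and ps: "distinct ps" "set ps = prime_factors n"
    and no_primitive: "\<And>p. prime p \<Longrightarrow> int p dvd D n \<Longrightarrow> \<exists>m. 1 \<le> m \<and> m < n \<and> int p dvd D m"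
  shows "mdiff ps (\<lambda>k. ln \<bar>of_int (D k)\<bar>) r \<le> 2 * ln (real n)"
proof -
  have Dn: "D n \<noteq> 0" using D_nonzero n(2) by simp
  define I where "I = prime_factors (D n)"
  have I: "finite I" "\<And>p. p \<in> I \<Longrightarrow> prime p \<and> p dvd D n"
    by (auto simp: I_def in_prime_factors_iff)
  have "mdiff ps (\<lambda>k. ln \<bar>of_int (D k)\<bar>) r
      = mdiff ps (\<lambda>k. \<Sum>p\<in>I. ln (of_int p) * real (multiplicity p (D k))) r"
    unfolding I_def using Dn
    by (intro mdiff_cong ln_abs_eq_sum_prime_factors D_dvd) (simp_all add: n(1) mult_dvd_mono)
  also have "\<dots> = (\<Sum>p\<in>I. ln (of_int p) * mdiff ps (\<lambda>k. real (multiplicity p (D k))) r)"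
    by (rule mdiff_sum)
  also have "\<dots> \<le> (\<Sum>p\<in>I. ln (of_int p) * (if p \<in> int ` set ps then 2 else 0))"
  proof (intro sum_mono mult_left_mono)
    fix p assume "p \<in> I"
    hence "prime p" "p dvd D n" using I(2) by auto
    then obtain p' where p': "p = int p'" "prime p'" "int p' dvd D n"
      by (cases p) (auto dest: prime_ge_0_int)
    show "mdiff ps (\<lambda>k. real (multiplicity p (D k))) r \<le> (if p \<in> int ` set ps then 2 else 0)"
      using mdiff_val_le[OF n ps p'(2,3) no_primitive[OF p'(2,3)]]
      by (simp add: p'(1) inj_image_mem_iff)
    show "0 \<le> ln (real_of_int p)"
      using p' prime_ge_2_nat[of p'] by simp
  qed
  also have "\<dots> = (\<Sum>p\<in>I \<inter> int ` set ps. ln (of_int p) * 2)"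
    using I(1) by (simp add: sum.inter_restrict if_distrib cong: if_cong)
  also have "\<dots> \<le> (\<Sum>p\<in>int ` set ps. ln (of_int p) * 2)"
    using ps(2) by (intro sum_mono2)
      (auto simp: in_prime_factors_iff Suc_leI prime_gt_0_nat)
  also have "\<dots> = 2 * (\<Sum>p\<in>set ps. ln (real p))"
    by (simp add: sum.reindex sum_distrib_left mult.commute)
  also have "(\<Sum>p\<in>set ps. ln (real p)) = ln (\<Prod>p\<in>set ps. real p)"
    using ps(2) by (intro ln_prod[symmetric]) (auto simp: in_prime_factors_iff prime_gt_0_nat)
  also have "(\<Prod>p\<in>set ps. real p) = real (prod_list ps)"
    using ps(1) by (simp add: prod.distinct_set_conv_list[of _ "\<lambda>x. x", simplified, symmetric])
  also have "2 * ln (real (prod_list ps)) \<le> 2 * ln (real n)"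
  proof -
    have "0 < prod_list ps" "0 < r" using n by (auto intro: Nat.gr0I)
    then show ?thesis by (simp add: n(1))
  qed
  finally show ?thesis by simp
qed

text \<open>Split ln |D k| into k ln |A|, which contributes ln |A| phi(n), and an error bounded by
  ln 4, which contributes at most 2^omega(n) ln 4. Replacing ln |A| by ln 2 removes the dependence
  on the unit.\<close>

lemma no_primitive_bound:
  assumes n: "n = r * prod_list ps" "n > 36"
    and ps: "distinct ps" "set ps = prime_factors n"
    and no_primitive: "\<And>p. prime p \<Longrightarrow> int p dvd D n \<Longrightarrow> \<exists>m. 1 \<le> m \<and> m < n \<and> int p dvd D m"
  shows "ln 2 * (real r * (\<Prod>p\<leftarrow>ps. real p - 1)) - 2 ^ length ps * ln 4 \<le> 2 * ln (real n)"
proof -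
  define h where "h k = ln (\<bar>of_int (D k)\<bar>) - ln (\<bar>A\<bar>) * real k" for k
  have r: "r \<ge> 1" using n by (cases r) auto
  have prime: "q \<ge> 1" if "q \<in> set ps" for q
    using that ps(2) by (auto simp: in_prime_factors_iff prime_ge_1_nat)
  have "(\<lambda>k. ln \<bar>of_int (D k)\<bar>) = (\<lambda>k. ln \<bar>A\<bar> * real k + h k)"
    by (simp add: h_def)
  hence "mdiff ps (\<lambda>k. ln \<bar>of_int (D k)\<bar>) r
      = ln \<bar>A\<bar> * (real r * (\<Prod>p\<leftarrow>ps. real p - 1)) + mdiff ps h r"
    by (simp add: mdiff_add mdiff_linear mult.assoc)
  moreover have "\<bar>mdiff ps h r\<bar> \<le> 2 ^ length ps * ln 4"
    unfolding h_def by (rule abs_mdiff_le[OF ln_D_approx r prime])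
  moreover have "ln 2 * (real r * (\<Prod>p\<leftarrow>ps. real p - 1)) \<le> ln \<bar>A\<bar> * (real r * (\<Prod>p\<leftarrow>ps. real p - 1))"
  proof (rule mult_right_mono)
    show "ln 2 \<le> ln \<bar>A\<bar>" using A_ge by simp
    show "0 \<le> real r * (\<Prod>p\<leftarrow>ps. real p - 1)"
      using prime by (intro mult_nonneg_nonneg prod_list_nonneg) auto
  qed
  moreover note mdiff_ln_le[OF n ps no_primitive]
  ultimately show ?thesis by simp
qed

end

section \<open>Totient estimates and the uniform bound on the index\<close>

text \<open>Factor by factor: p <= (p - 1)^2 for p >= 3, and p = 2 costs the factor 2. For n = r
  times its radical this yields n <= 2 phi(n)^2.\<close>

lemma prod_primes_le:
  fixes P :: "nat set"
  assumes "finite P" "\<And>p. p \<in> P \<Longrightarrow> prime p"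
  shows "(\<Prod>p\<in>P. real p) \<le> 2 * (\<Prod>p\<in>P. real p - 1)\<^sup>2"
proof -
  have "(\<Prod>p\<in>P. real p) \<le> (\<Prod>p\<in>P. (if p = 2 then 2 else 1) * (real p - 1)\<^sup>2)"
  proof (rule prod_mono, intro conjI)
    fix p assume "p \<in> P"
    hence "p \<ge> 2" using assms(2) prime_ge_2_nat by blast
    show "real p \<le> (if p = 2 then 2 else 1) * (real p - 1)\<^sup>2"
    proof (cases "p = 2")
      case False
      hence "2 * (real p - 1) \<le> (real p - 1) * (real p - 1)"
        using \<open>p \<ge> 2\<close> by (intro mult_right_mono) auto
      moreover have "real p \<le> 2 * (real p - 1)" using \<open>p \<ge> 2\<close> by simp
      ultimately show ?thesis using False by (simp add: power2_eq_square)
    qed simp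
  qed simp
  also have "\<dots> = (if 2 \<in> P then 2 else 1) * (\<Prod>p\<in>P. real p - 1)\<^sup>2"
    using assms(1) by (simp add: prod.distrib prod_power_distrib)
  also have "\<dots> \<le> 2 * (\<Prod>p\<in>P. real p - 1)\<^sup>2"
    by (intro mult_right_mono) auto
  finally show ?thesis .
qed

text \<open>4 <= p - 1 for p >= 5, while the primes 2 and 3 cost factors 4 and 2. It yields
  2^omega(n) <= sqrt(8 phi(n)).\<close>

lemma four_power_card_primes_le:
  fixes P :: "nat set"
  assumes "finite P" "\<And>p. p \<in> P \<Longrightarrow> prime p"
  shows "4 ^ card P \<le> 8 * (\<Prod>p\<in>P. real p - 1)"
proof -
  have ge: "p \<ge> 2" if "p \<in> P" for p using assms(2)[OF that] prime_ge_2_nat by blast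
  have "4 ^ card P = (\<Prod>p\<in>P. (4::real))" by simp
  also have "\<dots> \<le> (\<Prod>p\<in>P. (if p = 2 then 4 else 1) * (if p = 3 then 2 else 1) * (real p - 1))"
  proof (rule prod_mono, intro conjI)
    fix p assume "p \<in> P"
    hence "prime p" "p \<ge> 2" using assms(2) ge by auto
    moreover from this have "p \<noteq> 4" by (auto simp: prime_nat_iff dest: spec[of _ 2])
    ultimately have "p = 2 \<or> p = 3 \<or> p \<ge> 5" by linarith
    then show "(4::real) \<le> (if p = 2 then 4 else 1) * (if p = 3 then 2 else 1) * (real p - 1)"
      by auto
  qed simp
  also have "\<dots> = (if 2 \<in> P then 4 else 1) * (if 3 \<in> P then 2 else 1) * (\<Prod>p\<in>P. real p - 1)"
    using assms(1) by (simp add: prod.distrib)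
  also have "\<dots> \<le> 8 * (\<Prod>p\<in>P. real p - 1)"
    using ge by (intro mult_right_mono prod_nonneg) fastforce+
  finally show ?thesis .
qed

lemma reciprocal_pair_primitive:
  obtains C :: nat where
    "\<And>A B n. reciprocal_pair A B \<Longrightarrow> n > C \<Longrightarrow>
       \<exists>p. prime p \<and> int p dvd reciprocal_pair.D A B n \<and>
           (\<forall>m. 1 \<le> m \<and> m < n \<longrightarrow> \<not> int p dvd reciprocal_pair.D A B m)"
proof -
  have "\<forall>\<^sub>F x :: real in at_top. ln 2 * x - sqrt (8 * x) * ln 4 > 2 * ln (2 * x\<^sup>2)"
    by real_asymp
  \<comment> \<open>Here x stands for phi(n): the main term beats both the 2^omega(n) error and 2 ln
    n, where n <= 2 x^2.\<close>
  then obtain X0 where X0: "\<And>x. x \<ge> X0 \<Longrightarrow> ln 2 * x - sqrt (8 * x) * ln 4 > 2 * ln (2 * x\<^sup>2)"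
    by (auto simp: eventually_at_top_linorder)
  define X where "X = max X0 1"
  \<comment> \<open>36 is the threshold of \<open>val_rank_power\<close>; beyond 2 X^2 the bound n
    <= 2 phi(n)^2 forces phi(n) >= X.\<close>
  define C where "C = max 36 (nat \<lceil>2 * X\<^sup>2\<rceil>)"
  show thesis
  proof (rule that[of C], rule ccontr)
    fix A B :: real and n :: nat
    assume "reciprocal_pair A B" and n: "n > C"
    then interpret reciprocal_pair A B by simp
    assume no: "\<not> (\<exists>p. prime p \<and> int p dvd D n \<and> (\<forall>m. 1 \<le> m \<and> m < n \<longrightarrow> \<not> int p dvd D m))"
    define P where "P = prime_factors n"
    define ps where "ps = sorted_list_of_set P"
    have P: "finite P" "\<And>p. p \<in> P \<Longrightarrow> prime p" by (auto simp: P_def)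
    have ps: "distinct ps" "set ps = prime_factors n" "length ps = card P"
      using P(1) by (auto simp: ps_def P_def)
    have list: "prod_list (map g ps) = prod g P" for g :: "nat \<Rightarrow> 'a :: comm_monoid_mult"
      using ps(1,2) by (metis P_def prod.distinct_set_conv_list)
    have n36: "n > 36" and nX: "2 * X\<^sup>2 < real n"
      using n by (auto simp: C_def) linarith
    have "(\<Prod>p\<in>P. p) dvd (\<Prod>p\<in>P. p ^ multiplicity p n)"
      using n36 by (intro prod_dvd_prod dvd_power)
        (auto simp: P_def prime_factors_multiplicity)
    also have "\<dots> = n" using n36 by (simp add: P_def prod_prime_factors)
    finally obtain r where r: "n = r * prod_list ps"
      using list[of "\<lambda>x. x"] by (metis dvd_def map_ident mult.commute)
    \<comment> \<open>\<open>real r * \<Phi>\<close> is phi(n), as n is \<open>r\<close> times its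
      radical.\<close>
    define \<Phi> where "\<Phi> = (\<Prod>p\<in>P. real p - 1)"
    have \<Phi>1: "\<Phi> \<ge> 1"
      unfolding \<Phi>_def using P(2) by (intro prod_ge_1) (fastforce dest: prime_ge_2_nat)
    have r1: "real r \<ge> 1" using r n36 by (cases r) auto
    have "real n = real r * (\<Prod>p\<in>P. real p)"
      using list[of "\<lambda>x. x"] by (simp add: r of_nat_prod[symmetric] del: of_nat_prod)
    also have "\<dots> \<le> real r ^ 2 * (2 * \<Phi>\<^sup>2)"
      unfolding \<Phi>_def using r1 P
      by (intro mult_mono prod_primes_le) (auto simp: power2_eq_square intro: prod_nonneg)
    finally have n\<Phi>: "real n \<le> 2 * (real r * \<Phi>)\<^sup>2" by (simp add: power_mult_distrib mult_ac)
    hence "X\<^sup>2 \<le> (real r * \<Phi>)\<^sup>2" using nX by simp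
    hence "X \<le> real r * \<Phi>" by (rule power2_le_imp_le) (use r1 \<Phi>1 in simp)
    hence "2 * ln (2 * (real r * \<Phi>)\<^sup>2) < ln 2 * (real r * \<Phi>) - sqrt (8 * (real r * \<Phi>)) * ln 4"
      by (intro X0) (simp add: X_def)
    also have "\<dots> \<le> ln 2 * (real r * \<Phi>) - 2 ^ length ps * ln 4"
    proof -
      have "(2 ^ length ps)\<^sup>2 = (4 :: real) ^ card P"
        by (simp add: ps(3) power2_eq_square flip: power_mult_distrib)
      also have "\<dots> \<le> 8 * \<Phi>" unfolding \<Phi>_def by (rule four_power_card_primes_le[OF P])
      also have "\<dots> \<le> 8 * (real r * \<Phi>)" using r1 \<Phi>1 by simp
      finally have "2 ^ length ps \<le> sqrt (8 * (real r * \<Phi>))" by (rule real_le_rsqrt)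
      then show ?thesis by simp
    qed
    also have "\<dots> \<le> 2 * ln (real n)"
      using no_primitive_bound[OF r n36 ps(1,2)] no by (auto simp: list \<Phi>_def)
    also have "\<dots> \<le> 2 * ln (2 * (real r * \<Phi>)\<^sup>2)"
      using n\<Phi> n36 by (intro mult_left_mono ln_mono) auto
    finally show False by simp
  qed
qed

section \<open>Units of real quadratic fields\<close>

text \<open>With t = A + B, (A - B)^2 = t^2 - 4 is positive because A = B would give A^2 = 1; so the
  integer t satisfies |t| >= 3. One of the two numbers has absolute value at most 1, hence the other
  at least 2.\<close>

lemma reciprocal_pairI:
  assumes "A * B = 1" "A + B \<in> \<int>" "\<bar>A\<bar> \<noteq> 1"
  shows "reciprocal_pair A B \<or> reciprocal_pair B A"
proof -
  obtain t where t: "A + B = of_int t" using assms(2) by (auto elim: Ints_cases)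
  have "(of_int t)\<^sup>2 = (A - B)\<^sup>2 + 4"
    unfolding t[symmetric] using assms(1) by (simp add: power2_eq_square algebra_simps)
  hence *: "(A - B)\<^sup>2 = of_int (t\<^sup>2 - 4)" by simp
  have "A \<noteq> B"
  proof
    assume "A = B"
    hence "\<bar>A\<bar>\<^sup>2 = 1" using assms(1) by (simp add: power2_eq_square)
    then show False using assms(3) by (auto simp: power2_eq_1_iff)
  qed
  hence "(A - B)\<^sup>2 > 0" by simp
  hence "t\<^sup>2 > 2\<^sup>2" unfolding * by (simp only: of_int_0_less_iff) simp
  hence "\<bar>t\<bar> > 2" using abs_le_square_iff[of t 2] by simp
  hence t3: "\<bar>A + B\<bar> \<ge> 3" unfolding t by linarith
  have "\<bar>A\<bar> * \<bar>B\<bar> = 1" using assms(1) by (simp flip: abs_mult)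
  hence "\<bar>A\<bar> \<le> 1 \<or> \<bar>B\<bar> \<le> 1"
    by (metis less_1_mult less_irrefl not_le)
  hence "\<bar>A\<bar> \<ge> 2 \<or> \<bar>B\<bar> \<ge> 2" using t3 by linarith
  then show ?thesis using assms(1,2)
    by (auto simp: reciprocal_pair_def mult.commute add.commute)
qed

lemma field_embedding_of_int:
  assumes "field_embedding (\<sigma> :: 'k::field_char_0 \<Rightarrow> 'l::field_char_0)"
  shows "\<sigma> (of_int z) = of_int z"
proof -
  have \<sigma>: "\<sigma> 1 = 1" "\<And>x y. \<sigma> (x + y) = \<sigma> x + \<sigma> y"
    using assms by (auto simp: field_embedding_def)
  have 0: "\<sigma> 0 = 0" using \<sigma>(2)[of 0 0] by simp
  have neg: "\<sigma> (- x) = - \<sigma> x" for x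
    using \<sigma>(2)[of x "- x"] 0 by (simp add: eq_neg_iff_add_eq_0 add.commute)
  have "\<sigma> (of_nat n) = of_nat n" for n
    by (induction n) (simp_all add: 0 \<sigma>)
  then show ?thesis by (cases z) (simp_all add: neg \<sigma> del: of_nat_Suc)
qed

text \<open>A is the image of \<alpha> under a real embedding and B the other root of X^2 - t X + N.
  The powers of \<alpha>, A and B are u + v times the base with the same integers u, v, so the norm
  form of \<alpha>^n - 1 becomes the product over the two roots.\<close>

lemma unit_conjugates:
  fixes \<alpha> :: "'k::field_char_0"
  assumes K: "real_quadratic_field TYPE('k)"
    and \<alpha>: "\<alpha> \<in> integer_units - {1, - 1}" "field_norm \<alpha> = of_int N"
  obtains A B :: real where "A * B = of_int N" "A + B \<in> \<int>" "\<bar>A\<bar> \<noteq> 1"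
    "\<And>n. of_int (norm_seq \<alpha> n) = (A ^ n - 1) * (B ^ n - 1)"
proof -
  have dim: "rat_vs.dim (UNIV :: 'k set) = 2"
    using K by (auto simp: real_quadratic_field_def)
  obtain \<sigma> :: "'k \<Rightarrow> real" where \<sigma>: "field_embedding \<sigma>"
    using K by (auto simp: real_quadratic_field_def)
  obtain y where alg: "algebraic_int \<alpha>" and y: "algebraic_int y" "\<alpha> * y = 1"
    using \<alpha>(1) by (auto simp: integer_units_def ring_of_integers_def)
  \<comment> \<open>A rational unit is an integer dividing 1, hence 1 or -1.\<close>
  have irr: "\<alpha> \<notin> \<rat>"
  proof
    assume rat: "\<alpha> \<in> \<rat>"
    have "y = 1 / \<alpha>" using y(2) by (metis nonzero_mult_div_cancel_left mult_zero_left zero_neq_one)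
    hence "y \<in> \<rat>" using rat by simp
    then obtain i j where "\<alpha> = of_int i" "y = of_int j"
      using rational_algebraic_int_is_int[OF alg rat] rational_algebraic_int_is_int[OF y(1)]
      by (auto elim!: Ints_cases)
    moreover from this have "i * j = 1"
      using y(2) by (metis of_int_eq_1_iff of_int_mult)
    hence "i = 1 \<or> i = - 1" by (metis zmult_eq_1_iff)
    ultimately show False using \<alpha>(1) by auto
  qed
  obtain a b c d where
    norm: "\<And>u v. field_norm (of_rat u + of_rat v * \<alpha>)
      = (u + v * a) * (u + v * d) - (v * b) * (v * c)"
    and eq: "\<alpha>\<^sup>2 - of_rat (a + d) * \<alpha> + of_rat (a * d - b * c) = 0"
    by (rule field_norm_quadratic[OF dim, of \<alpha>]) (rule that)
  obtain t where t: "a + d = of_int t"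
    using quadratic_coeffs_int[OF alg irr eq] by (auto elim!: Ints_cases)
  have N: "a * d - b * c = of_int N"
    using norm[of 0 1] \<alpha>(2) by simp
  have sq: "\<alpha> * \<alpha> = of_int t * \<alpha> - of_int N"
    using eq by (simp add: t N power2_eq_square algebra_simps add_eq_0_iff)
  have hom: "\<sigma> 1 = 1" "\<sigma> (x + z) = \<sigma> x + \<sigma> z" "\<sigma> (x * z) = \<sigma> x * \<sigma> z"
    "\<sigma> (of_int k) = of_int k" for x z k
    using \<sigma> field_embedding_of_int[OF \<sigma>] by (auto simp: field_embedding_def)
  have inj: "x = z" if "\<sigma> x = \<sigma> z" for x z
  proof (rule ccontr)
    assume "x \<noteq> z"
    hence "\<sigma> (x - z) * \<sigma> (inverse (x - z)) = 1" by (simp flip: hom(3) add: hom(1))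
    moreover have "\<sigma> (x - z) = 0" using hom(2)[of "x - z" z] that by simp
    ultimately show False by simp
  qed
  define A B where "A = \<sigma> \<alpha>" and "B = of_int t - \<sigma> \<alpha>"
  have sqA: "A * A = of_int t * A - of_int N"
  proof -
    have "\<alpha> * \<alpha> = of_int t * \<alpha> + of_int (- N)" using sq by simp
    hence "\<sigma> (\<alpha> * \<alpha>) = \<sigma> (of_int t * \<alpha> + of_int (- N))" by (rule arg_cong)
    then show ?thesis unfolding hom A_def by simp
  qed
  show thesis
  proof
    show AB: "A * B = of_int N" using sqA by (simp add: B_def A_def algebra_simps)
    show "A + B \<in> \<int>" by (simp add: A_def B_def)
    \<comment> \<open>The embedding is injective, so A = 1 or A = -1 would carry back to
      \<alpha>.\<close>
    have "A \<noteq> of_int k" if "\<alpha> \<noteq> of_int k" for k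
      using inj[of \<alpha> "of_int k"] that by (auto simp: A_def hom)
    from this[of 1] this[of "- 1"] show "\<bar>A\<bar> \<noteq> 1" using \<alpha>(1) by auto
    have sqB: "B * B = of_int t * B - of_int N"
      using AB by (simp add: A_def B_def algebra_simps)
    fix n
    have "\<exists>u v. \<alpha> ^ n = of_int u + of_int v * \<alpha> \<and> A ^ n = of_int u + of_int v * A
        \<and> B ^ n = of_int u + of_int v * B"
    proof (induction n)
      case 0
      show ?case by (intro exI[of _ 1] exI[of _ 0]) simp
    next
      case (Suc n)
      then obtain u v where uv: "\<alpha> ^ n = of_int u + of_int v * \<alpha>"
        "A ^ n = of_int u + of_int v * A" "B ^ n = of_int u + of_int v * B" by blast
      have step: "x * (of_int u + of_int v * x) = of_int (- v * N) + of_int (u + v * t) * x"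
        if "x * x = of_int t * x - of_int N" for x :: "'b::comm_ring_1"
      proof -
        have "x * (of_int u + of_int v * x) = of_int u * x + of_int v * (x * x)"
          by (simp add: algebra_simps)
        then show ?thesis unfolding that by (simp add: algebra_simps)
      qed
      show ?case
        using step[OF sq] step[OF sqA] step[OF sqB] uv by (intro exI conjI) (simp_all only: power_Suc)
    qed
    then obtain u v where uv: "\<alpha> ^ n = of_int u + of_int v * \<alpha>"
      "A ^ n = of_int u + of_int v * A" "B ^ n = of_int u + of_int v * B" by blast
    have "\<alpha> ^ n - 1 = of_rat (of_int (u - 1)) + of_rat (of_int v) * \<alpha>"
      by (simp only: of_rat_of_int_eq uv) simp
    hence "field_norm (\<alpha> ^ n - 1) =
        (of_int (u - 1) + of_int v * a) * (of_int (u - 1) + of_int v * d)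
        - (of_int v * b) * (of_int v * c)"
      by (simp only: norm)
    also have "\<dots> = of_int (u - 1) ^ 2 + of_int (u - 1) * of_int v * (a + d)
        + of_int v ^ 2 * (a * d - b * c)"
      by (simp add: algebra_simps power2_eq_square)
    also have "\<dots> = of_int ((u - 1)\<^sup>2 + (u - 1) * v * t + v ^ 2 * N)"
      unfolding t N by simp
    finally have "norm_seq \<alpha> n = (u - 1)\<^sup>2 + (u - 1) * v * t + v ^ 2 * N"
      by (simp only: norm_seq_def floor_of_int)
    moreover have "(A ^ n - 1) * (B ^ n - 1)
      = of_int (u - 1) ^ 2 + of_int (u - 1) * of_int v * (A + B) + of_int v ^ 2 * (A * B)"
      by (simp add: uv algebra_simps power2_eq_square)
    moreover have "A + B = of_int t" by (simp add: A_def B_def)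
    ultimately show "of_int (norm_seq \<alpha> n) = (A ^ n - 1) * (B ^ n - 1)"
      by (simp add: AB)
  qed
qed

text \<open>As A B = 1, (A^n - 1) (B^n - 1) = 2 - A^n - B^n. This is symmetric, so it does not
  matter which conjugate is the larger one.\<close>

lemma unit_norm_one:
  fixes \<alpha> :: "'k::field_char_0"
  assumes "real_quadratic_field TYPE('k)" "\<alpha> \<in> integer_units - {1, - 1}" "field_norm \<alpha> = 1"
  obtains A B where "reciprocal_pair A B" "\<And>n. norm_seq \<alpha> n = - reciprocal_pair.D A B n"
proof -
  obtain A B :: real where AB: "A * B = 1" "A + B \<in> \<int>" "\<bar>A\<bar> \<noteq> 1"
    and norm: "\<And>n. of_int (norm_seq \<alpha> n) = (A ^ n - 1) * (B ^ n - 1)"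
    using unit_conjugates[OF assms(1,2), of 1] assms(3) by auto
  have eq: "norm_seq \<alpha> n = - reciprocal_pair.D A' B' n"
    if R: "reciprocal_pair A' B'" and "{A', B'} = {A, B}" for A' B' n
  proof -
    have "A ^ n * B ^ n = 1" using AB(1) by (simp flip: power_mult_distrib)
    hence "of_int (norm_seq \<alpha> n) = - (A' ^ n + B' ^ n - 2)"
      unfolding norm using that(2) by (auto simp: doubleton_eq_iff algebra_simps)
    also have "\<dots> = of_int (- reciprocal_pair.D A' B' n)"
      by (simp add: reciprocal_pair.of_int_D[OF R])
    finally show ?thesis by (simp only: of_int_eq_iff)
  qed
  show thesis
    using reciprocal_pairI[OF AB] eq that by (metis insert_commute)
qed

text \<open>The squares of the conjugates form the reciprocal pair. For odd n, (A B)^n = -1 makes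
  the norm equal to -(A^n + B^n), whose square is A^(2n) + B^(2n) - 2.\<close>

lemma unit_norm_minus_one:
  fixes \<alpha> :: "'k::field_char_0"
  assumes "real_quadratic_field TYPE('k)" "\<alpha> \<in> integer_units - {1, - 1}" "field_norm \<alpha> = - 1"
  obtains A B where "reciprocal_pair A B"
    "\<And>n. norm_seq \<alpha> (2 * n) = - reciprocal_pair.D A B n"
    "\<And>n. odd n \<Longrightarrow> (norm_seq \<alpha> n)\<^sup>2 = reciprocal_pair.D A B n"
proof -
  obtain A B :: real where AB: "A * B = - 1" "A + B \<in> \<int>" "\<bar>A\<bar> \<noteq> 1"
    and norm: "\<And>n. of_int (norm_seq \<alpha> n) = (A ^ n - 1) * (B ^ n - 1)"
    using unit_conjugates[OF assms(1,2), of "- 1"] assms(3) by auto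
  have AB2: "A\<^sup>2 * B\<^sup>2 = 1" using AB(1) by (simp flip: power_mult_distrib)
  moreover have "A\<^sup>2 + B\<^sup>2 = (A + B)\<^sup>2 + 2"
    using AB(1) by (simp add: power2_eq_square algebra_simps)
  hence "A\<^sup>2 + B\<^sup>2 \<in> \<int>" using AB(2) by simp
  moreover have "\<bar>A\<^sup>2\<bar> \<noteq> 1" using AB(3) by (auto simp: power2_eq_1_iff)
  ultimately have or: "reciprocal_pair (A\<^sup>2) (B\<^sup>2) \<or> reciprocal_pair (B\<^sup>2) (A\<^sup>2)"
    by (rule reciprocal_pairI)
  have eq: "norm_seq \<alpha> (2 * n) = - reciprocal_pair.D A' B' n"
    "odd n \<Longrightarrow> (norm_seq \<alpha> n)\<^sup>2 = reciprocal_pair.D A' B' n"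
    if R: "reciprocal_pair A' B'" and "{A', B'} = {A\<^sup>2, B\<^sup>2}" for A' B' n
  proof -
    have D: "of_int (reciprocal_pair.D A' B' n) = (A\<^sup>2) ^ n + (B\<^sup>2) ^ n - 2"
      using that(2) by (auto simp: reciprocal_pair.of_int_D[OF R] doubleton_eq_iff)
    have "(A\<^sup>2) ^ n * (B\<^sup>2) ^ n = 1" using AB2 by (simp flip: power_mult_distrib)
    hence "of_int (norm_seq \<alpha> (2 * n)) = - ((A\<^sup>2) ^ n + (B\<^sup>2) ^ n - 2)"
      unfolding norm power_mult by (simp add: algebra_simps)
    also have "\<dots> = of_int (- reciprocal_pair.D A' B' n)" by (simp add: D)
    finally show "norm_seq \<alpha> (2 * n) = - reciprocal_pair.D A' B' n" by (simp only: of_int_eq_iff)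
    assume "odd n"
    have ABn: "A ^ n * B ^ n = - 1" using AB(1) \<open>odd n\<close> by (simp flip: power_mult_distrib)
    hence "of_int (norm_seq \<alpha> n) = - (A ^ n + B ^ n)"
      unfolding norm by (simp add: algebra_simps)
    hence "of_int ((norm_seq \<alpha> n)\<^sup>2) = (A ^ n + B ^ n)\<^sup>2"
      by (simp only: of_int_power power2_minus)
    also have "\<dots> = (A ^ n)\<^sup>2 + (B ^ n)\<^sup>2 - 2" using ABn by (simp add: power2_sum)
    also have "\<dots> = of_int (reciprocal_pair.D A' B' n)"
      unfolding D by (simp add: mult.commute flip: power_mult)
    finally show "(norm_seq \<alpha> n)\<^sup>2 = reciprocal_pair.D A' B' n" by (simp only: of_int_eq_iff)
  qed
  from or show thesis
  proof
    assume R: "reciprocal_pair (A\<^sup>2) (B\<^sup>2)"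
    show thesis by (rule that[OF R eq[OF R refl]])
  next
    assume R: "reciprocal_pair (B\<^sup>2) (A\<^sup>2)"
    show thesis by (rule that[OF R eq[OF R insert_commute]])
  qed
qed

section \<open>Transfer to the norm sequences of units\<close>

theorem corollary1p3:
  assumes "real_quadratic_field TYPE('k::field_char_0)"
  shows
    "(\<exists>C1::nat. C1 > 0 \<and>
        (\<forall>\<alpha> \<in> (integer_units :: 'k set) - {1, - 1}. field_norm \<alpha> = 1 \<longrightarrow>
           zsigmondy_bound (norm_seq \<alpha>) \<le> enat C1)) \<and>
     (\<exists>C2::nat. C2 > 0 \<and>
        (\<forall>\<alpha> \<in> (integer_units :: 'k set) - {1, - 1}. field_norm \<alpha> = - 1 \<longrightarrow>
           (\<forall>n > C2. n mod 4 \<noteq> 2 \<longrightarrow> has_primitive_prime_divisor (norm_seq \<alpha>) n)))"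
proof -
  obtain C where C: "\<And>A B n. reciprocal_pair A B \<Longrightarrow> n > C \<Longrightarrow>
       \<exists>p. prime p \<and> int p dvd reciprocal_pair.D A B n \<and>
           (\<forall>m. 1 \<le> m \<and> m < n \<longrightarrow> \<not> int p dvd reciprocal_pair.D A B m)"
    using reciprocal_pair_primitive by blast
  \<comment> \<open>\<open>Suc C\<close> instead of \<open>C\<close> makes the constant
    positive.\<close>
  have "zsigmondy_bound (norm_seq \<alpha>) \<le> enat (Suc C)"
    if \<alpha>: "\<alpha> \<in> integer_units - {1, - 1}" "field_norm \<alpha> = 1" for \<alpha> :: 'k
  proof -
    obtain A B where R: "reciprocal_pair A B"
      and norm: "\<And>n. norm_seq \<alpha> n = - reciprocal_pair.D A B n"
      using unit_norm_one[OF assms \<alpha>] by blast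
    define S where "S = {n. 1 \<le> n \<and> \<not> has_primitive_prime_divisor (norm_seq \<alpha>) n}"
    have "has_primitive_prime_divisor (norm_seq \<alpha>) n" if "n > C" for n
      using C[OF R that]
      by (auto simp: has_primitive_prime_divisor_def primitive_prime_divisor_def norm)
    hence "S \<subseteq> {..C}" unfolding S_def by (auto simp: not_le[symmetric])
    hence "finite S" "\<And>n. n \<in> S \<Longrightarrow> n \<le> Suc C" by (auto intro: finite_subset)
    then show ?thesis
      unfolding zsigmondy_bound_def Let_def S_def[symmetric] by simp
  qed
  \<comment> \<open>Beyond 2 C + 1 both n, used when n is odd, and n / 2, used when n is even,
    exceed \<open>C\<close>.\<close>
  moreover have "has_primitive_prime_divisor (norm_seq \<alpha>) n"
    if \<alpha>: "\<alpha> \<in> integer_units - {1, - 1}" "field_norm \<alpha> = - 1"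
      and n: "n > 2 * C + 1" "n mod 4 \<noteq> 2" for \<alpha> :: 'k and n
  proof -
    obtain A B where R: "reciprocal_pair A B"
      and even: "\<And>n. norm_seq \<alpha> (2 * n) = - reciprocal_pair.D A B n"
      and odd: "\<And>n. odd n \<Longrightarrow> (norm_seq \<alpha> n)\<^sup>2 = reciprocal_pair.D A B n"
      using unit_norm_minus_one[OF assms \<alpha>] by blast
    interpret reciprocal_pair A B by (rule R)
    have dvd_odd: "int p dvd norm_seq \<alpha> m \<longleftrightarrow> int p dvd D m" if "odd m" "prime p" for p m
      using that by (simp flip: odd add: prime_dvd_power_iff)
    have dvd_even: "int p dvd norm_seq \<alpha> (2 * m) \<longleftrightarrow> int p dvd D m" for p m
      by (simp add: even)
    show ?thesis
    proof (cases "odd n")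
      case True
      obtain p where p: "prime p" "int p dvd D n" "\<And>m. 1 \<le> m \<Longrightarrow> m < n \<Longrightarrow> \<not> int p dvd D m"
        using C[OF R, of n] n(1) by auto
      \<comment> \<open>A term of odd index m has the prime divisors of \<open>D m\<close>, one of
        index 2 j those of \<open>D j\<close>; both indices are below n.\<close>
      have "\<not> int p dvd norm_seq \<alpha> m" if "1 \<le> m" "m < n" for m
      proof (cases "odd m")
        case False
        then obtain j where "m = 2 * j" by (auto elim: evenE)
        then show ?thesis using p(3)[of j] that dvd_even by simp
      qed (use p(1,3) that dvd_odd in simp)
      then show ?thesis using p(1,2) dvd_odd[OF True]
        by (auto simp: has_primitive_prime_divisor_def primitive_prime_divisor_def)
    next
      case False
      then obtain k where k: "n = 2 * k" by (auto elim: evenE)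
      \<comment> \<open>Here the residue class 2 modulo 4 is excluded. A prime that is primitive for
        \<open>D k\<close> divides \<open>D m\<close> only if k | m, which an even k rules out for
        the odd indices m below 2 k; for odd k, m = k would be an obstruction.\<close>
      have "even k" using n(2) k by presburger
      obtain p where p: "prime p" "int p dvd D k" "\<And>m. 1 \<le> m \<Longrightarrow> m < k \<Longrightarrow> \<not> int p dvd D m"
        using C[OF R, of k] n(1) k by auto
      have "\<not> int p dvd norm_seq \<alpha> m" if "1 \<le> m" "m < n" for m
      proof (cases "odd m")
        case True
        have "\<not> int p dvd D m"
        proof
          assume "int p dvd D m"
          hence "k dvd m" using rank_dvd[of "int p" k m] p n(1) k by auto
          then show False using True \<open>even k\<close> dvd_trans by blast
        qed
        then show ?thesis using dvd_odd True p(1) by simp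
      next
        case False
        then obtain j where "m = 2 * j" by (auto elim: evenE)
        then show ?thesis using p(3)[of j] that dvd_even k by simp
      qed
      then show ?thesis using p(1,2) dvd_even k
        by (auto simp: has_primitive_prime_divisor_def primitive_prime_divisor_def)
    qed
  qed
  ultimately show ?thesis
    by (intro conjI exI[of _ "Suc C"] exI[of _ "2 * C + 1"]) auto
qed

end
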